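(* Let $X_{\xi l}\colon G\to\mathbb C$, $\xi=1,\dots,n$, $l=1,\dots,2m$, and suppose that the system of total differential equations $$dw_\xi=\sum_{j=1}^m\bigl(X_{\xi j}(z,w)\,dz_j+X_{\xi,m+j}(z,w)\,d\overline z_j\bigr),\qquad \xi=1,\dots,n,$$ is completely solvable in the domain $G\subset\mathbb C^{m+n}$. If the functions $X_{\xi l}$, $\xi=1,\dots,n$, $l=1,\dots,2m$, are $\mathbb R$-holomorphic at a point $(z_0,w_0)\in G$, then the system has a unique solution $w=w(z)$ that is $\mathbb R$-holomorphic at the point $z_0$ and satisfies the initial condition $w(z_0)=w_0$.
   Context: $G\subset\mathbb C^{m+n}$ is a domain with points $(z,w)$, $z=(z_1,\dots,z_m)$, $w=(w_1,\dots,w_n)$; $\overline z_j,\overline w_\xi$ are complex conjugates and $\partial_{z_j},\partial_{\overline z_j},\partial_{w_\xi},\partial_{\overline w_\xi}$ are the formal (Wirtinger) derivatives. A function $g\colon\mathscr D\to\mathbb C$, $\mathscr D\subset\mathbb C^m$, is $\mathbb R$-holomorphic at $z_0=(z_1^0,\dots,z_m^0)\in\mathscr D$ if in some neighborhood $U(z_0)\subset\mathscr D$ it is the sum of an absolutely convergent series $$g(z)=\sum_{k_1+l_1+\dots+k_m+l_m=0}^{+\infty}c_{k_1l_1\dots k_ml_m}\prod_{j=1}^m(z_j-z_j^0)^{k_j}(\overline z_j-\overline z_j^{\,0})^{l_j},\quad z\in U(z_0),$$ with complex coefficients and nonnegative integer exponents (and similarly for functions of $(z,w)$). A vector function is $\mathbb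 R$-holomorphic if its components are. Standing assumption: the functions $X_{\xi l}$ are $\mathbb R$-holomorphic in the domain $G$. Put, for $j=1,\dots,m$, $$\mathfrak X_j=\partial_{z_j}+\sum_{\xi=1}^n\bigl(X_{\xi j}\partial_{w_\xi}+\overline X_{\xi,m+j}\partial_{\overline w_\xi}\bigr),\qquad \mathfrak X_{m+j}=\partial_{\overline z_j}+\sum_{\xi=1}^n\bigl(X_{\xi,m+j}\partial_{w_\xi}+\overline X_{\xi j}\partial_{\overline w_\xi}\bigr),$$ where $\overline X_{\xi l}$ is the complex conjugate of $X_{\xi l}$. The system is completely solvable in $G$ if the Frobenius conditions hold: for all $\tau=1,\dots,n$ and $j,\zeta=1,\dots,m$, everywhere in $G$, $$\mathfrak X_\zeta X_{\tau j}=\mathfrak X_jX_{\tau\zeta},\qquad \mathfrak X_{m+\zeta}X_{\tau,m+j}=\mathfrak X_{m+j}X_{\tau,m+\zeta},\qquad \mathfrak X_\zeta X_{\tau,m+j}=\mathfrak X_{m+j}X_{\tau\zeta}.$$ *)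

theory Defs
  imports "HOL-Analysis.Analysis"
begin

text \<open>
  Coordinates on \<open>C^(m+n)\<close> are indexed by \<open>'m + 'n\<close>: \<open>Inl j\<close> is the coordinate \<open>z_j\<close> and
  \<open>Inr \<xi>\<close> the coordinate \<open>w_\<xi>\<close>.
  The second index of \<open>X\<close>, which runs over \<open>1, ..., 2m\<close>, has type \<open>'m + 'm\<close>: \<open>Inl j\<close> is the
  index \<open>j\<close> and \<open>Inr j\<close> the index \<open>m + j\<close>.
\<close>

definition join :: "complex ^ 'm \<Rightarrow> complex ^ 'n \<Rightarrow> complex ^ ('m + 'n)" where
  "join z w = (\<chi> i. case i of Inl j \<Rightarrow> z $ j | Inr \<xi> \<Rightarrow> w $ \<xi>)"

definition R_holomorphic_at ::
  "(complex ^ 'k) set \<Rightarrow> (complex ^ 'k \<Rightarrow> complex) \<Rightarrow> complex ^ 'k \<Rightarrow> bool" where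
  "R_holomorphic_at D g a \<longleftrightarrow>
     (\<exists>U (c :: ('k \<Rightarrow> nat) \<Rightarrow> ('k \<Rightarrow> nat) \<Rightarrow> complex).
        open U \<and> a \<in> U \<and> U \<subseteq> D \<and>
        (\<forall>z\<in>U.
           (\<lambda>(k, l). norm (c k l * (\<Prod>j\<in>UNIV. (z $ j - a $ j) ^ k j * (cnj (z $ j) - cnj (a $ j)) ^ l j)))
             summable_on UNIV \<and>
           ((\<lambda>(k, l). c k l * (\<Prod>j\<in>UNIV. (z $ j - a $ j) ^ k j * (cnj (z $ j) - cnj (a $ j)) ^ l j))
             has_sum g z) UNIV))"

definition R_holomorphic_vec_at ::
  "(complex ^ 'k) set \<Rightarrow> (complex ^ 'k \<Rightarrow> complex ^ 'n) \<Rightarrow> complex ^ 'k \<Rightarrow> bool" where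
  "R_holomorphic_vec_at D g a \<longleftrightarrow> (\<forall>\<xi>. R_holomorphic_at D (\<lambda>z. g z $ \<xi>) a)"

definition dir_deriv :: "complex ^ 'k \<Rightarrow> (complex ^ 'k \<Rightarrow> complex) \<Rightarrow> complex ^ 'k \<Rightarrow> complex" where
  "dir_deriv v f p = vector_derivative (\<lambda>t::real. f (p + t *\<^sub>R v)) (at 0)"

text \<open>
  With the \<open>i\<close>-th coordinate written \<open>x + \<i> y\<close>, the partial derivatives in \<open>x\<close> and \<open>y\<close> are the
  directional derivatives along \<open>axis i 1\<close> and \<open>axis i \<i>\<close>.
\<close>

definition wirt :: "'k \<Rightarrow> (complex ^ 'k \<Rightarrow> complex) \<Rightarrow> complex ^ 'k \<Rightarrow> complex" where
  "wirt i f p = (dir_deriv (axis i 1) f p - \<i> * dir_deriv (axis i \<i>) f p) / 2"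

definition wirt_bar :: "'k \<Rightarrow> (complex ^ 'k \<Rightarrow> complex) \<Rightarrow> complex ^ 'k \<Rightarrow> complex" where
  "wirt_bar i f p = (dir_deriv (axis i 1) f p + \<i> * dir_deriv (axis i \<i>) f p) / 2"

text \<open>
  \<open>frakX X (Inl j)\<close> and \<open>frakX X (Inr j)\<close> are the operators usually written with a Fraktur X and
  index \<open>j\<close> and \<open>m + j\<close>, respectively.
\<close>

fun frakX ::
  "('n \<Rightarrow> 'm + 'm \<Rightarrow> complex ^ ('m + 'n) \<Rightarrow> complex) \<Rightarrow> 'm + 'm \<Rightarrow>
   (complex ^ ('m::finite + 'n::finite) \<Rightarrow> complex) \<Rightarrow> complex ^ ('m + 'n) \<Rightarrow> complex" where
  "frakX X (Inl j) f p =
     wirt (Inl j) f p +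
     (\<Sum>\<xi>\<in>UNIV. X \<xi> (Inl j) p * wirt (Inr \<xi>) f p + cnj (X \<xi> (Inr j) p) * wirt_bar (Inr \<xi>) f p)"
| "frakX X (Inr j) f p =
     wirt_bar (Inl j) f p +
     (\<Sum>\<xi>\<in>UNIV. X \<xi> (Inr j) p * wirt (Inr \<xi>) f p + cnj (X \<xi> (Inl j) p) * wirt_bar (Inr \<xi>) f p)"

definition completely_solvable ::
  "('n \<Rightarrow> 'm + 'm \<Rightarrow> complex ^ ('m + 'n) \<Rightarrow> complex) \<Rightarrow> (complex ^ ('m::finite + 'n::finite)) set \<Rightarrow> bool"
where
  "completely_solvable X G \<longleftrightarrow>
     (\<forall>\<tau> j \<zeta>. \<forall>p\<in>G.
        frakX X (Inl \<zeta>) (X \<tau> (Inl j)) p = frakX X (Inl j) (X \<tau> (Inl \<zeta>)) p \<and>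
        frakX X (Inr \<zeta>) (X \<tau> (Inr j)) p = frakX X (Inr j) (X \<tau> (Inr \<zeta>)) p \<and>
        frakX X (Inl \<zeta>) (X \<tau> (Inr j)) p = frakX X (Inr j) (X \<tau> (Inl \<zeta>)) p)"

text \<open>
  \<open>w\<close>, defined on the domain \<open>D\<close>, is a solution: its graph lies in \<open>G\<close> and its total (real) differential
  is the one prescribed by the system, where \<open>dz_j (h) = h $ j\<close> and its conjugate sends \<open>h\<close> to
  \<open>cnj (h $ j)\<close>.
\<close>

definition is_solution ::
  "('n \<Rightarrow> 'm + 'm \<Rightarrow> complex ^ ('m + 'n) \<Rightarrow> complex) \<Rightarrow> (complex ^ ('m::finite + 'n::finite)) set \<Rightarrow>
   (complex ^ 'm) set \<Rightarrow> (complex ^ 'm \<Rightarrow> complex ^ 'n) \<Rightarrow> bool" where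
  "is_solution X G D w \<longleftrightarrow>
     open D \<and> connected D \<and>
     (\<forall>z\<in>D. join z (w z) \<in> G \<and>
        (\<forall>\<xi>. ((\<lambda>z. w z $ \<xi>) has_derivative
               (\<lambda>h. \<Sum>j\<in>UNIV. X \<xi> (Inl j) (join z (w z)) * h $ j
                               + X \<xi> (Inr j) (join z (w z)) * cnj (h $ j))) (at z)))"

definition R_holomorphic_solution ::
  "('n \<Rightarrow> 'm + 'm \<Rightarrow> complex ^ ('m + 'n) \<Rightarrow> complex) \<Rightarrow> (complex ^ ('m::finite + 'n::finite)) set \<Rightarrow>
   complex ^ 'm \<Rightarrow> complex ^ 'n \<Rightarrow> (complex ^ 'm) set \<Rightarrow> (complex ^ 'm \<Rightarrow> complex ^ 'n) \<Rightarrow> bool" where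
  "R_holomorphic_solution X G z0 w0 D w \<longleftrightarrow>
     z0 \<in> D \<and> is_solution X G D w \<and> R_holomorphic_vec_at D w z0 \<and> w z0 = w0"

end

theory Submission
  imports Defs
begin

text \<open>
  The system prescribes the real differential of \<open>w\<close> as \<open>dw = A(z, w) dz\<close>, where \<open>A\<close> has the
  coefficients \<open>X\<close>.  Along the ray through \<open>z0\<close> in direction \<open>s\<close> it becomes an ordinary
  differential equation, so a solution \<open>w = w0 + u(z - z0)\<close> must satisfy
  \<open>u(s) = (\<integral> A(z0 + t s, w0 + u(t s)) dt) s\<close> with \<open>t\<close> from \<open>0\<close> to \<open>1\<close>.
  Existence is proved in two steps: this radial equation has an analytic solution \<open>u\<close>, and complete solvability makes the radial solution a
  solution in all directions.

  The first step is a Picard iteration carried out on power series in the coordinates and their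
  conjugates.  The size of a series is measured by \<open>\<Sum> |c| r^degree\<close>, the predicate \<open>series_bounded\<close>.
  Bounds of this kind are preserved by products, by composition, by infinite sums and by integration along rays (a monomial of degree \<open>d\<close> is divided by \<open>d + 1\<close>), and
  \<open>X(z, u(z))\<close> is Lipschitz in \<open>u\<close> for this norm (\<open>series_bounded_compose_diff\<close>).  Since the integral is
  multiplied by \<open>s\<close>, the iteration is a contraction for small \<open>r\<close>, and its limit is itself
  a convergent series (\<open>series_bounded_fixed_point\<close>, \<open>radial_solution_exists\<close>).

  For the second step (\<open>radial_solution_is_total_solution\<close>) the defect
  \<open>v(t) = u(t(s + h)) - u(t s) - t A(t s) h\<close>, with \<open>A(t s)\<close> taken at the point of the graph over \<open>t s\<close>, is
  differentiated in \<open>t\<close>.  The Frobenius conditions say that the derivative of \<open>A\<close> along its own graph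
  is symmetric, \<open>DA(k, A k) h = DA(h, A h) k\<close> (\<open>frobenius_symmetry\<close>); this cancels the terms of first
  order in \<open>h\<close> and leaves \<open>|v'| \<le> C |h|\<^sup>2 + |v| / 2\<close> when \<open>s\<close> is small.  Hence \<open>v(1) = O(|h|\<^sup>2)\<close>, which
  says that \<open>u\<close> has the differential \<open>A\<close>.

  Uniqueness holds because \<open>A\<close> is locally Lipschitz: on a short segment from a point where two
  solutions agree, their difference obeys \<open>|v'| \<le> |v| / 2\<close> and so vanishes.  The agreement set is
  therefore open and closed in the connected component of the common domain.
\<close>

section \<open>Power series with a bounded weighted coefficient sum\<close>

type_synonym 'k bidegree = "('k \<Rightarrow> nat) \<times> ('k \<Rightarrow> nat)"

definition monom_at :: "'k::finite bidegree \<Rightarrow> complex ^ 'k \<Rightarrow> complex" where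
  "monom_at p z = (\<Prod>j\<in>UNIV. (z $ j) ^ fst p j * cnj (z $ j) ^ snd p j)"

definition total_degree :: "'k::finite bidegree \<Rightarrow> nat" where
  "total_degree p = (\<Sum>j\<in>UNIV. fst p j + snd p j)"

definition add_bidegree :: "'k bidegree \<Rightarrow> 'k bidegree \<Rightarrow> 'k bidegree" where
  "add_bidegree p q = (\<lambda>j. fst p j + fst q j, \<lambda>j. snd p j + snd q j)"

definition polydisc :: "real \<Rightarrow> (complex ^ 'k) set" where
  "polydisc r = {z. \<forall>j. norm (z $ j) \<le> r}"

text \<open>
  The ball of radius \<open>M\<close> in the weighted \<open>\<ell>\<^sup>1\<close> algebra of power series at the origin.  It is a
  predicate on functions rather than a norm on a type of series, because the fixed point argument only
  ever compares such bounds; nothing is asserted outside the polydisc.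
\<close>

definition series_bounded :: "real \<Rightarrow> real \<Rightarrow> (complex ^ 'k::finite \<Rightarrow> complex) \<Rightarrow> bool" where
  "series_bounded r M f \<longleftrightarrow> 0 < r \<and>
     (\<exists>c S. ((\<lambda>p. norm (c p) * r ^ total_degree p) has_sum S) UNIV \<and> S \<le> M \<and>
        (\<forall>z\<in>polydisc r. ((\<lambda>p. c p * monom_at p z) has_sum f z) UNIV))"

lemma monom_at_add: "monom_at (add_bidegree p q) z = monom_at p z * monom_at q z"
  by (simp add: monom_at_def add_bidegree_def power_add prod.distrib mult_ac)

lemma total_degree_add: "total_degree (add_bidegree p q) = total_degree p + total_degree q"
  by (simp add: total_degree_def add_bidegree_def sum.distrib)

lemma norm_monom_at_le:
  assumes "z \<in> polydisc r"
  shows "norm (monom_at p z) \<le> r ^ total_degree p"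
proof -
  have "norm (monom_at p z) = (\<Prod>j\<in>UNIV. norm (z $ j) ^ (fst p j + snd p j))"
    by (simp add: monom_at_def prod_norm[symmetric] norm_mult norm_power power_add)
  also have "\<dots> \<le> (\<Prod>j\<in>UNIV. r ^ (fst p j + snd p j))"
    using assms by (intro prod_mono conjI power_mono) (auto simp: polydisc_def)
  also have "\<dots> = r ^ total_degree p"
    by (simp add: total_degree_def power_sum)
  finally show ?thesis .
qed

lemma zero_in_polydisc: "0 \<le> r \<Longrightarrow> 0 \<in> polydisc r"
  by (simp add: polydisc_def)

text \<open>
  The family of terms may be indexed by any type and may repeat monomials; absolute convergence allows
  terms with the same exponents to be collected, and collecting only decreases the norm.  Thus the
  closure properties below need no formula for the coefficients of a product or an infinite sum.
\<close>

lemma series_bounded_regroup: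
  fixes a :: "'i \<Rightarrow> complex" and e :: "'i \<Rightarrow> 'k::finite bidegree"
  assumes r: "0 < r"
    and S: "((\<lambda>i. norm (a i) * r ^ total_degree (e i)) has_sum S) UNIV" "S \<le> M"
    and f: "\<And>z. z \<in> polydisc r \<Longrightarrow> ((\<lambda>i. a i * monom_at (e i) z) has_sum f z) UNIV"
  shows "series_bounded r M f"
proof -
  define F where "F p = {i. e i = p}" for p
  have reindex: "((\<lambda>i. h (e i) i) has_sum T) UNIV \<longleftrightarrow> ((\<lambda>(p, i). h p i) has_sum T) (Sigma UNIV F)"
    for h :: "'k bidegree \<Rightarrow> 'i \<Rightarrow> 'c::real_normed_vector" and T
    by (rule has_sum_reindex_bij_witness[where i = snd and j = "\<lambda>i. (e i, i)"]) (auto simp: F_def)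
  define N where "N p = infsum (\<lambda>i. norm (a i) * r ^ total_degree p) (F p)" for p
  have SS: "((\<lambda>(p, i). norm (a i) * r ^ total_degree p) has_sum S) (Sigma UNIV F)"
    using S(1) reindex[of "\<lambda>p i. norm (a i) * r ^ total_degree p" S] by simp
  have fib: "(\<lambda>i. norm (a i) * r ^ total_degree p) summable_on F p" for p
    using summable_on_SigmaD1[where f = "\<lambda>p i. norm (a i) * r ^ total_degree p" and A = UNIV and B = F and x = p]
      SS has_sum_imp_summable by auto
  have NS: "(N has_sum S) UNIV"
    using has_sum_SigmaD[OF SS, of N] fib by (simp add: N_def)
  define c where "c p = infsum a (F p)" for p
  have absF: "(\<lambda>i. norm (a i)) summable_on F p" for p
    using summable_on_cmult_left[OF fib[of p], of "inverse (r ^ total_degree p)"] r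
    by (simp add: field_simps)
  have aF: "(a has_sum c p) (F p)" for p
    unfolding c_def by (rule has_sum_infsum[OF abs_summable_summable[OF absF]])
  have cN: "norm (c p) * r ^ total_degree p \<le> N p" for p
    unfolding c_def N_def infsum_cmult_left'
    using norm_infsum_bound[OF absF[of p]] r by (intro mult_right_mono) auto
  have sc: "(\<lambda>p. norm (c p) * r ^ total_degree p) summable_on UNIV"
    by (rule summable_on_comparison_test[OF has_sum_imp_summable[OF NS]]) (use cN r in auto)
  then obtain S' where S': "((\<lambda>p. norm (c p) * r ^ total_degree p) has_sum S') UNIV"
    using has_sum_infsum by blast
  have "S' \<le> S"
    by (rule has_sum_mono[OF S' NS]) (use cN in auto)
  moreover have "((\<lambda>p. c p * monom_at p z) has_sum f z) UNIV" if "z \<in> polydisc r" for z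
  proof (rule has_sum_SigmaD)
    show "((\<lambda>(p, i). a i * monom_at p z) has_sum f z) (Sigma UNIV F)"
      using f[OF that] reindex[of "\<lambda>p i. a i * monom_at p z"] by simp
    show "((\<lambda>i. (case (p, i) of (p, i) \<Rightarrow> a i * monom_at p z)) has_sum c p * monom_at p z) (F p)" for p
      using has_sum_cmult_left[OF aF] by simp
  qed
  ultimately show ?thesis
    unfolding series_bounded_def using r S' S(2) by (intro conjI exI[of _ c] exI[of _ S']) auto
qed

lemma series_bounded_pos: "series_bounded r M f \<Longrightarrow> 0 < r"
  by (simp add: series_bounded_def)

lemma series_bounded_mono: "series_bounded r M f \<Longrightarrow> M \<le> N \<Longrightarrow> series_bounded r N f"
  unfolding series_bounded_def by (blast intro: order_trans)

lemma series_bounded_cong: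
  assumes "series_bounded r M f" "\<And>z. z \<in> polydisc r \<Longrightarrow> f z = g z"
  shows "series_bounded r M g"
proof -
  have "(\<forall>z\<in>polydisc r. (h z has_sum f z) UNIV) \<longleftrightarrow> (\<forall>z\<in>polydisc r. (h z has_sum g z) UNIV)"
    for h :: "_ \<Rightarrow> 'a bidegree \<Rightarrow> complex"
    using assms(2) by simp
  with assms(1) show ?thesis by (simp add: series_bounded_def)
qed

lemma abs_summable_terms:
  fixes c :: "'k::finite bidegree \<Rightarrow> complex"
  assumes "(\<lambda>p. norm (c p) * r ^ total_degree p) summable_on UNIV" "z \<in> polydisc r"
  shows "(\<lambda>p. norm (c p * monom_at p z)) summable_on UNIV"
  by (rule Infinite_Sum.abs_summable_on_comparison_test'[OF assms(1)])
    (simp add: norm_mult mult_left_mono norm_monom_at_le[OF assms(2)])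

lemma series_bounded_norm_le:
  assumes "series_bounded r M f" "z \<in> polydisc r"
  shows "norm (f z) \<le> M"
proof -
  obtain c S where c: "((\<lambda>p. norm (c p) * r ^ total_degree p) has_sum S) UNIV" "S \<le> M"
    "((\<lambda>p. c p * monom_at p z) has_sum f z) UNIV"
    using assms unfolding series_bounded_def by blast
  obtain T where T: "((\<lambda>p. norm (c p * monom_at p z)) has_sum T) UNIV"
    using abs_summable_terms[OF has_sum_imp_summable[OF c(1)] assms(2)] has_sum_infsum by blast
  have "norm (f z) \<le> T"
    by (rule norm_has_sum_bound[OF T c(3)])
  also have "T \<le> S"
    by (rule has_sum_mono[OF T c(1)]) (simp add: norm_mult mult_left_mono norm_monom_at_le[OF assms(2)])
  finally show ?thesis using c(2) by simp
qed

lemma series_bounded_nonneg: "series_bounded r M f \<Longrightarrow> 0 \<le> M"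
  by (rule order_trans[OF norm_ge_zero, OF series_bounded_norm_le[OF _ zero_in_polydisc]])
    (auto dest: series_bounded_pos)

lemma has_sum_times:
  fixes f :: "'i \<Rightarrow> 'c::{real_normed_field, banach}" and g :: "'j \<Rightarrow> 'c"
  assumes "(f has_sum a) UNIV" "(g has_sum b) UNIV" "(\<lambda>i. norm (f i)) summable_on UNIV" "(\<lambda>j. norm (g j)) summable_on UNIV"
  shows "((\<lambda>(i, j). f i * g j) has_sum a * b) UNIV"
proof -
  have "((\<lambda>(i, j). f i * g j) has_sum a * b) (UNIV \<times> UNIV)"
  proof (rule has_sum_SigmaI)
    show "((\<lambda>j. case (i, j) of (i, j) \<Rightarrow> f i * g j) has_sum f i * b) UNIV" for i
      using has_sum_cmult_right[OF assms(2)] by simp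
    show "((\<lambda>i. f i * b) has_sum a * b) UNIV"
      using has_sum_cmult_left[OF assms(1)] by simp
    show "(\<lambda>(i, j). f i * g j) summable_on UNIV \<times> UNIV"
    proof (rule abs_summable_summable)
      have "(\<lambda>(i, j). norm (f i) * norm (g j)) summable_on UNIV \<times> UNIV"
      proof (rule summable_on_SigmaI)
        show "((\<lambda>j. case (i, j) of (i, j) \<Rightarrow> norm (f i) * norm (g j)) has_sum
            norm (f i) * infsum (\<lambda>j. norm (g j)) UNIV) UNIV" for i
          using has_sum_cmult_right[OF has_sum_infsum[OF assms(4)]] by simp
        show "(\<lambda>i. norm (f i) * infsum (\<lambda>j. norm (g j)) UNIV) summable_on UNIV"
          by (intro summable_on_cmult_left assms(3))
      qed (auto intro: mult_nonneg_nonneg)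
      then show "(\<lambda>x. norm (case x of (i, j) \<Rightarrow> f i * g j)) summable_on UNIV \<times> UNIV"
        by (simp add: case_prod_unfold norm_mult)
    qed
  qed
  then show ?thesis by simp
qed

lemma series_bounded_mult:
  fixes f g :: "complex ^ 'k::finite \<Rightarrow> complex"
  assumes "series_bounded r M f" "series_bounded r N g"
  shows "series_bounded r (M * N) (\<lambda>z. f z * g z)"
proof -
  from assms(1) obtain c S where c: "((\<lambda>p. norm (c p) * r ^ total_degree p) has_sum S) UNIV" "S \<le> M"
    "\<And>z. z \<in> polydisc r \<Longrightarrow> ((\<lambda>p. c p * monom_at p z) has_sum f z) UNIV" and r: "0 < r"
    unfolding series_bounded_def by blast
  from assms(2) obtain d T where d: "((\<lambda>p. norm (d p) * r ^ total_degree p) has_sum T) UNIV" "T \<le> N"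
    "\<And>z. z \<in> polydisc r \<Longrightarrow> ((\<lambda>p. d p * monom_at p z) has_sum g z) UNIV"
    unfolding series_bounded_def by blast
  have "0 \<le> S"
    by (rule has_sum_nonneg[OF c(1)]) (use r in auto)
  have "0 \<le> T"
    by (rule has_sum_nonneg[OF d(1)]) (use r in auto)
  show ?thesis
  proof (rule series_bounded_regroup[OF r, where S = "S * T"
        and a = "\<lambda>(p, q). c p * d q" and e = "\<lambda>(p, q). add_bidegree p q"])
    have "((\<lambda>(p, q). (norm (c p) * r ^ total_degree p) * (norm (d q) * r ^ total_degree q)) has_sum S * T) UNIV"
      by (rule has_sum_times[OF c(1) d(1)])
        (use c(1) d(1) has_sum_imp_summable r in \<open>auto simp: norm_mult\<close>)
    then show "((\<lambda>i. norm (case i of (p, q) \<Rightarrow> c p * d q) *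
              r ^ total_degree (case i of (p, q) \<Rightarrow> add_bidegree p q)) has_sum S * T) UNIV"
      by (simp add: case_prod_unfold norm_mult total_degree_add power_add mult_ac)
    show "S * T \<le> M * N"
      using c(2) d(2) \<open>0 \<le> S\<close> \<open>0 \<le> T\<close> by (intro mult_mono) auto
    fix z :: "complex ^ 'k" assume z: "z \<in> polydisc r"
    have "((\<lambda>(p, q). (c p * monom_at p z) * (d q * monom_at q z)) has_sum f z * g z) UNIV"
      by (intro has_sum_times c(3) d(3) z abs_summable_terms[OF _ z] has_sum_imp_summable[OF c(1)] 
            has_sum_imp_summable[OF d(1)])
    then show "((\<lambda>i. (case i of (p, q) \<Rightarrow> c p * d q) * monom_at (case i of (p, q) \<Rightarrow> add_bidegree p q) z)
          has_sum f z * g z) UNIV"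
      by (simp add: case_prod_unfold monom_at_add mult_ac)
  qed
qed

lemma series_bounded_infsum:
  fixes f :: "'i \<Rightarrow> complex ^ 'k::finite \<Rightarrow> complex"
  assumes r: "0 < r"
    and f: "\<And>i. series_bounded r (M i) (f i)" and M: "(M has_sum N) UNIV"
    and g: "\<And>z. z \<in> polydisc r \<Longrightarrow> ((\<lambda>i. f i z) has_sum g z) UNIV"
  shows "series_bounded r N g"
proof -
  define R where "R i c S \<longleftrightarrow> ((\<lambda>p. norm (c p) * r ^ total_degree p) has_sum S) UNIV \<and> S \<le> M i \<and>
        (\<forall>z\<in>polydisc r. ((\<lambda>p. c p * monom_at p z) has_sum f i z) UNIV)" for i c S
  have "\<exists>c S. R i c S" for i
    using f[of i] unfolding series_bounded_def R_def by blast
  then obtain c S where "\<And>i. R i (c i) (S i)"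
    by metis
  then have c: "\<And>i. ((\<lambda>p. norm (c i p) * r ^ total_degree p) has_sum S i) UNIV"
    "\<And>i. S i \<le> M i" "\<And>i z. z \<in> polydisc r \<Longrightarrow> ((\<lambda>p. c i p * monom_at p z) has_sum f i z) UNIV"
    unfolding R_def by blast+
  have S0: "0 \<le> S i" for i
    by (rule has_sum_nonneg[OF c(1)]) (use r in auto)
  have SM: "S summable_on UNIV"
    by (rule summable_on_comparison_test[OF has_sum_imp_summable[OF M]]) (use c(2) S0 in auto)
  then obtain T where T: "(S has_sum T) UNIV" using has_sum_infsum by blast
  have sm: "(\<lambda>(i, p). norm (c i p) * r ^ total_degree p) summable_on UNIV \<times> UNIV"
    by (rule summable_on_SigmaI[OF _ SM]) (use c(1) r in auto)
  have TT: "((\<lambda>(i, p). norm (c i p) * r ^ total_degree p) has_sum T) (UNIV \<times> UNIV)"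
    by (rule has_sum_SigmaI[OF _ T sm]) (use c(1) in auto)
  show ?thesis
  proof (rule series_bounded_regroup[OF r, where S = T and a = "\<lambda>(i, p). c i p" and e = snd])
    show "((\<lambda>i. norm (case i of (i, p) \<Rightarrow> c i p) * r ^ total_degree (snd i)) has_sum T) UNIV"
      using TT by (simp add: case_prod_unfold)
    show "T \<le> N" by (rule has_sum_mono[OF T M]) (use c(2) in auto)
    fix z :: "complex ^ 'k" assume z: "z \<in> polydisc r"
    have "((\<lambda>(i, p). c i p * monom_at p z) has_sum g z) (UNIV \<times> UNIV)"
    proof (rule has_sum_SigmaI[OF _ g[OF z]])
      show "((\<lambda>p. case (i, p) of (i, p) \<Rightarrow> c i p * monom_at p z) has_sum f i z) UNIV" for i
        using c(3)[OF z] by simp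
      have "(\<lambda>x. norm (case x of (i, p) \<Rightarrow> c i p * monom_at p z)) summable_on (UNIV \<times> UNIV)"
        by (rule Infinite_Sum.abs_summable_on_comparison_test'[OF sm])
          (auto simp: norm_mult mult_left_mono norm_monom_at_le[OF z])
      then show "(\<lambda>(i, p). c i p * monom_at p z) summable_on (UNIV \<times> UNIV)"
        by (rule abs_summable_summable)
    qed
    then show "((\<lambda>i. (case i of (i, p) \<Rightarrow> c i p) * monom_at (snd i) z) has_sum g z) UNIV"
      by (simp add: case_prod_unfold)
  qed
qed

lemma series_bounded_monom:
  assumes "0 < r"
  shows "series_bounded r (norm a * r ^ total_degree p) (\<lambda>z. a * monom_at p z)"
proof (rule series_bounded_regroup[OF assms])
  show "((\<lambda>i::unit. norm a * r ^ total_degree p) has_sum norm a * r ^ total_degree p) UNIV"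
    by (rule has_sum_finiteI) (simp_all add: UNIV_unit)
  show "((\<lambda>i::unit. a * monom_at p z) has_sum a * monom_at p z) UNIV" for z
    by (rule has_sum_finiteI) (simp_all add: UNIV_unit)
qed simp

lemma series_bounded_const:
  assumes "0 < r" shows "series_bounded r (norm a) (\<lambda>z. a)"
  using series_bounded_monom[OF assms, of a "(\<lambda>_. 0, \<lambda>_. 0)"] by (simp add: monom_at_def total_degree_def)

lemma series_bounded_zero: "0 < r \<Longrightarrow> 0 \<le> M \<Longrightarrow> series_bounded r M (\<lambda>z. 0)"
  using series_bounded_mono[OF series_bounded_const[of r 0]] by simp

lemma monom_at_unit: 
  "monom_at (\<lambda>i. if i = j then 1 else 0, \<lambda>_. 0) z = z $ j"
proof -
  have "x ^ (if i = j then 1 else 0) = (if i = j then x else 1)" for x :: complex and i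
    by simp
  then show "monom_at (\<lambda>i. if i = j then 1 else 0, \<lambda>_. 0) z = z $ j"
    by (simp_all only: monom_at_def fst_conv snd_conv power_0 mult_1 mult_1_right prod.delta) auto
qed

lemma total_degree_unit: 
  "total_degree (\<lambda>i. if i = j then 1 else 0, \<lambda>_. 0) = 1"
  by (simp add: total_degree_def)

lemma series_bounded_coord:
  assumes "0 < r" shows "series_bounded r r (\<lambda>z. z $ j)"
  using series_bounded_monom[OF assms, of 1 "(\<lambda>i. if i = j then 1 else 0, \<lambda>_. 0)"] 
  by (simp only: monom_at_unit total_degree_unit) simp

lemma series_bounded_cnj:
  fixes f :: "complex ^ 'k::finite \<Rightarrow> complex"
  assumes "series_bounded r M f"
  shows "series_bounded r M (\<lambda>z. cnj (f z))"
proof -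
  from assms obtain c S where c: "((\<lambda>p. norm (c p) * r ^ total_degree p) has_sum S) UNIV" "S \<le> M"
    "\<And>z. z \<in> polydisc r \<Longrightarrow> ((\<lambda>p. c p * monom_at p z) has_sum f z) UNIV" and r: "0 < r"
    unfolding series_bounded_def by blast
  show ?thesis
  proof (rule series_bounded_regroup[OF r _ c(2), where a = "\<lambda>p. cnj (c p)" and e = prod.swap])
    have "total_degree (prod.swap p) = total_degree p" for p :: "'k bidegree"
      by (simp add: total_degree_def add.commute)
    then show "((\<lambda>i. norm (cnj (c i)) * r ^ total_degree (prod.swap i)) has_sum S) UNIV"
      using c(1) by simp
    fix z :: "complex ^ 'k" assume z: "z \<in> polydisc r"
    have swap: "monom_at (prod.swap p) z = cnj (monom_at p z)" for p
      by (simp add: monom_at_def mult.commute)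
    show "((\<lambda>i. cnj (c i) * monom_at (prod.swap i) z) has_sum cnj (f z)) UNIV"
      unfolding swap complex_cnj_mult[symmetric] has_sum_cnj_iff by (rule c(3)[OF z])
  qed
qed

lemma series_bounded_add:
  assumes "series_bounded r M f" "series_bounded r N g"
  shows "series_bounded r (M + N) (\<lambda>z. f z + g z)"
proof (rule series_bounded_infsum)
  show "0 < r" by (rule series_bounded_pos[OF assms(1)])
  show "series_bounded r (if b then M else N) (if b then f else g)" for b
    using assms by simp
  show "((\<lambda>b. if b then M else N) has_sum M + N) UNIV"
    by (rule has_sum_finiteI) (simp_all add: UNIV_bool add.commute)
  show "((\<lambda>b. (if b then f else g) z) has_sum f z + g z) UNIV" for z
    by (rule has_sum_finiteI) (simp_all add: UNIV_bool add.commute)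
qed

lemma series_bounded_cmult:
  assumes "series_bounded r M f" shows "series_bounded r (norm a * M) (\<lambda>z. a * f z)"
  using series_bounded_mult[OF series_bounded_const assms, of a] series_bounded_pos[OF assms] by simp

lemma series_bounded_diff:
  assumes "series_bounded r M f" "series_bounded r N g"
  shows "series_bounded r (M + N) (\<lambda>z. f z - g z)"
  using series_bounded_add[OF assms(1) series_bounded_cmult[OF assms(2), of "-1"]] by simp

lemma series_bounded_sum:
  assumes "0 < r" "\<And>i. i \<in> A \<Longrightarrow> series_bounded r (M i) (f i)"
  shows "series_bounded r (\<Sum>i\<in>A. M i) (\<lambda>z. \<Sum>i\<in>A. f i z)"
  using assms(2)
proof (induction A rule: infinite_finite_induct)
  case (insert x F)
  then show ?case by (simp add: series_bounded_add)
qed (use series_bounded_const[OF assms(1), of 0] in auto)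

section \<open>Composition of series\<close>

lemma series_bounded_power:
  assumes "series_bounded r M f"
  shows "series_bounded r (M ^ n) (\<lambda>z. f z ^ n)"
proof (induction n)
  case 0
  then show ?case using series_bounded_const[of r 1] series_bounded_pos[OF assms] by simp
next
  case (Suc n)
  then show ?case using series_bounded_mult[OF assms Suc] by simp
qed

lemma series_bounded_prod:
  assumes "0 < r" "\<And>i. i \<in> A \<Longrightarrow> series_bounded r (M i) (f i)"
  shows "series_bounded r (\<Prod>i\<in>A. M i) (\<lambda>z. \<Prod>i\<in>A. f i z)"
  using assms(2)
proof (induction A rule: infinite_finite_induct)
  case (insert x F)
  then show ?case by (simp add: series_bounded_mult)
qed (use series_bounded_const[OF assms(1), of 1] in auto)

lemma series_bounded_monom_compose:
  fixes y :: "complex ^ 'm::finite \<Rightarrow> complex ^ 'k::finite"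
  assumes "0 < r" "\<And>i. series_bounded r \<rho> (\<lambda>z. y z $ i)"
  shows "series_bounded r (\<rho> ^ total_degree p) (\<lambda>z. monom_at p (y z))"
proof -
  have "series_bounded r (\<Prod>j\<in>UNIV. \<rho> ^ fst p j * \<rho> ^ snd p j)
          (\<lambda>z. \<Prod>j\<in>UNIV. (y z $ j) ^ fst p j * cnj (y z $ j) ^ snd p j)"
    by (intro series_bounded_prod series_bounded_mult series_bounded_power series_bounded_cnj assms)
  then show ?thesis
    by (simp add: monom_at_def total_degree_def power_add power_sum)
qed

lemma polydisc_of_series_bounded:
  assumes "\<And>i. series_bounded r \<rho> (\<lambda>z. y z $ i)" "z \<in> polydisc r"
  shows "y z \<in> polydisc \<rho>"
  using series_bounded_norm_le[OF assms(1) assms(2)] by (simp add: polydisc_def)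

text \<open>
  Submultiplicativity bounds each monomial in \<open>y\<close> by the same power of \<open>\<rho>\<close> that the norm of \<open>f\<close>
  uses as a weight, so the substituted series is dominated term by term by that of \<open>f\<close>.
\<close>

lemma series_bounded_compose:
  fixes y :: "complex ^ 'm::finite \<Rightarrow> complex ^ 'k::finite"
  assumes f: "series_bounded \<rho> M f" and r: "0 < r" and y: "\<And>i. series_bounded r \<rho> (\<lambda>z. y z $ i)"
  shows "series_bounded r M (\<lambda>z. f (y z))"
proof -
  from f obtain c S where c: "((\<lambda>p. norm (c p) * \<rho> ^ total_degree p) has_sum S) UNIV" "S \<le> M"
    "\<And>z. z \<in> polydisc \<rho> \<Longrightarrow> ((\<lambda>p. c p * monom_at p z) has_sum f z) UNIV"
    unfolding series_bounded_def by blast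
  have "series_bounded r S (\<lambda>z. f (y z))"
  proof (rule series_bounded_infsum[OF r _ c(1)])
    show "series_bounded r (norm (c p) * \<rho> ^ total_degree p) (\<lambda>z. c p * monom_at p (y z))" for p
      by (intro series_bounded_cmult series_bounded_monom_compose r y)
    show "((\<lambda>p. c p * monom_at p (y z)) has_sum f (y z)) UNIV" if "z \<in> polydisc r" for z
      by (intro c(3) polydisc_of_series_bounded[OF y that])
  qed
  then show ?thesis using c(2) by (rule series_bounded_mono)
qed

lemma series_bounded_shrink:
  fixes f :: "complex ^ 'k::finite \<Rightarrow> complex"
  assumes "series_bounded r M f" "0 < s" "s \<le> r"
  shows "series_bounded s M f"
  by (rule series_bounded_compose[OF assms(1,2), of "\<lambda>z. z"])
    (rule series_bounded_mono[OF series_bounded_coord[OF assms(2)] assms(3)])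

text \<open>
  The telescoping estimate for a difference of two products of \<open>d\<close> factors: each factor has norm at
  most \<open>\<rho>\<close>, and corresponding factors differ by at most \<open>\<epsilon> \<rho>\<close>.  Normalising the difference by \<open>\<rho>\<close>
  avoids the exponent \<open>d - 1\<close>.
\<close>

definition close_pair ::
  "real \<Rightarrow> real \<Rightarrow> real \<Rightarrow> nat \<Rightarrow> (complex ^ 'k::finite \<Rightarrow> complex) \<Rightarrow> (complex ^ 'k \<Rightarrow> complex) \<Rightarrow> bool" where
  "close_pair r \<rho> \<epsilon> d f g \<longleftrightarrow>
     series_bounded r (\<rho> ^ d) f \<and> series_bounded r (\<rho> ^ d) g \<and>
     series_bounded r (d * \<rho> ^ d * \<epsilon>) (\<lambda>z. f z - g z)"

lemma close_pair_mult:
  assumes "close_pair r \<rho> \<epsilon> d f g" "close_pair r \<rho> \<epsilon> e f' g'"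
  shows "close_pair r \<rho> \<epsilon> (d + e) (\<lambda>z. f z * f' z) (\<lambda>z. g z * g' z)"
proof -
  have "series_bounded r (d * \<rho> ^ d * \<epsilon> * \<rho> ^ e + \<rho> ^ d * (e * \<rho> ^ e * \<epsilon>))
      (\<lambda>z. (f z - g z) * f' z + g z * (f' z - g' z))"
    using assms by (intro series_bounded_add series_bounded_mult) (auto simp: close_pair_def)
  then have "series_bounded r ((d + e) * \<rho> ^ (d + e) * \<epsilon>) (\<lambda>z. f z * f' z - g z * g' z)"
    by (simp add: algebra_simps power_add)
  then show ?thesis
    using assms by (simp add: close_pair_def power_add series_bounded_mult)
qed

lemma close_pair_one: "0 < r \<Longrightarrow> close_pair r \<rho> \<epsilon> 0 (\<lambda>z. 1) (\<lambda>z. 1)"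
  using series_bounded_const[of r 1] series_bounded_const[of r 0] by (simp add: close_pair_def)

lemma close_pair_power:
  assumes "0 < r" "close_pair r \<rho> \<epsilon> 1 f g"
  shows "close_pair r \<rho> \<epsilon> n (\<lambda>z. f z ^ n) (\<lambda>z. g z ^ n)"
proof (induction n)
  case (Suc n)
  then show ?case using close_pair_mult[OF assms(2) Suc] by simp
qed (use close_pair_one[OF assms(1)] in simp)

lemma close_pair_prod:
  assumes "0 < r" "\<And>i. i \<in> A \<Longrightarrow> close_pair r \<rho> \<epsilon> (d i) (f i) (g i)"
  shows "close_pair r \<rho> \<epsilon> (\<Sum>i\<in>A. d i) (\<lambda>z. \<Prod>i\<in>A. f i z) (\<lambda>z. \<Prod>i\<in>A. g i z)"
  using assms(2)
proof (induction A rule: infinite_finite_induct)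
  case (insert x F)
  then show ?case by (simp add: close_pair_mult)
qed (use close_pair_one[OF assms(1)] in auto)

lemma close_pair_monom:
  fixes y y' :: "complex ^ 'm::finite \<Rightarrow> complex ^ 'k::finite"
  assumes r: "0 < r" and y: "\<And>i. close_pair r \<rho> \<epsilon> 1 (\<lambda>z. y z $ i) (\<lambda>z. y' z $ i)"
  shows "close_pair r \<rho> \<epsilon> (total_degree p) (\<lambda>z. monom_at p (y z)) (\<lambda>z. monom_at p (y' z))"
proof -
  have "close_pair r \<rho> \<epsilon> 1 (\<lambda>z. cnj (y z $ i)) (\<lambda>z. cnj (y' z $ i))" for i
    using y[of i] series_bounded_cnj[of r _ "\<lambda>z. y z $ i - y' z $ i"]
    by (simp add: close_pair_def series_bounded_cnj)
  then show ?thesis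
    unfolding monom_at_def total_degree_def
    by (intro close_pair_prod close_pair_mult close_pair_power r y)
qed

text \<open>
  Substitution is Lipschitz.  The telescoping estimate costs a factor equal to the degree \<open>d\<close>; it is
  paid for by the gap between the radii \<open>\<rho>\<close> and \<open>2 \<rho>\<close>, since \<open>d \<le> 2\<^sup>d\<close>.
\<close>

lemma series_bounded_compose_diff:
  fixes y y' :: "complex ^ 'm::finite \<Rightarrow> complex ^ 'k::finite"
  assumes f: "series_bounded (2 * \<rho>) M f" and r: "0 < r"
    and y: "\<And>i. series_bounded r \<rho> (\<lambda>z. y z $ i)" "\<And>i. series_bounded r \<rho> (\<lambda>z. y' z $ i)"
    and d: "\<And>i. series_bounded r \<epsilon> (\<lambda>z. y z $ i - y' z $ i)"
  shows "series_bounded r (M * (\<epsilon> / \<rho>)) (\<lambda>z. f (y z) - f (y' z))"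
proof -
  have \<rho>: "0 < \<rho>" using series_bounded_pos[OF f] by simp
  have \<epsilon>: "0 \<le> \<epsilon>" by (rule series_bounded_nonneg[OF d])
  from f obtain c S where c: "((\<lambda>p. norm (c p) * (2 * \<rho>) ^ total_degree p) has_sum S) UNIV" "S \<le> M"
    "\<And>z. z \<in> polydisc (2 * \<rho>) \<Longrightarrow> ((\<lambda>p. c p * monom_at p z) has_sum f z) UNIV"
    unfolding series_bounded_def by blast
  have sub: "polydisc \<rho> \<subseteq> polydisc (2 * \<rho>)"
    using \<rho> by (auto simp: polydisc_def intro: order_trans)
  have cp: "close_pair r \<rho> (\<epsilon> / \<rho>) (total_degree p) (\<lambda>z. monom_at p (y z)) (\<lambda>z. monom_at p (y' z))" for p
    by (rule close_pair_monom[OF r]) (use y d \<rho> in \<open>simp add: close_pair_def\<close>)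
  have le: "real d * \<rho> ^ d * (\<epsilon> / \<rho>) \<le> (2 * \<rho>) ^ d * (\<epsilon> / \<rho>)" for d :: nat
  proof -
    have "real d \<le> 2 ^ d"
      using of_nat_mono[OF less_imp_le[OF less_exp[of d]], where 'a = real] by simp
    then show ?thesis using \<rho> \<epsilon> by (intro mult_right_mono) (auto simp: power_mult_distrib)
  qed
  have "series_bounded r (S * (\<epsilon> / \<rho>)) (\<lambda>z. f (y z) - f (y' z))"
  proof (rule series_bounded_infsum[OF r])
    show "((\<lambda>p. norm (c p) * (2 * \<rho>) ^ total_degree p * (\<epsilon> / \<rho>)) has_sum S * (\<epsilon> / \<rho>)) UNIV"
      by (rule has_sum_cmult_left[OF c(1)])
    show "series_bounded r (norm (c p) * (2 * \<rho>) ^ total_degree p * (\<epsilon> / \<rho>))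
        (\<lambda>z. c p * (monom_at p (y z) - monom_at p (y' z)))" for p
      unfolding mult.assoc
      by (rule series_bounded_cmult[OF series_bounded_mono[OF _ le]]) (use cp[of p] in \<open>simp add: close_pair_def\<close>)
    show "((\<lambda>p. c p * (monom_at p (y z) - monom_at p (y' z))) has_sum f (y z) - f (y' z)) UNIV"
      if "z \<in> polydisc r" for z
    proof -
      have "((\<lambda>p. c p * monom_at p (y z) + - (c p * monom_at p (y' z))) has_sum f (y z) + - f (y' z)) UNIV"
        by (intro has_sum_add has_sum_uminusI c(3) subsetD[OF sub]
            polydisc_of_series_bounded[OF y(1) that] polydisc_of_series_bounded[OF y(2) that])
      then show ?thesis by (simp add: algebra_simps)
    qed
  qed
  moreover have "S * (\<epsilon> / \<rho>) \<le> M * (\<epsilon> / \<rho>)"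
    using c(2) \<rho> \<epsilon> by (intro mult_right_mono) auto
  ultimately show ?thesis by (rule series_bounded_mono)
qed

section \<open>Integration along rays\<close>

lemma monom_at_scaleR: "monom_at p (t *\<^sub>R z) = of_real t ^ total_degree p * monom_at p z"
proof -
  have "(t *\<^sub>R z) $ j = of_real t * z $ j" for j
    by (rule trans[OF vector_scaleR_component scaleR_conv_of_real])
  then have "monom_at p (t *\<^sub>R z) =
      (\<Prod>j\<in>UNIV. of_real t ^ (fst p j + snd p j) * ((z $ j) ^ fst p j * cnj (z $ j) ^ snd p j))"
    by (simp add: monom_at_def power_mult_distrib power_add mult_ac)
  then show ?thesis
    by (simp add: prod.distrib total_degree_def power_sum monom_at_def)
qed

lemma polydisc_scaleR:
  assumes "z \<in> polydisc r" "t \<in> {0..1}"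
  shows "t *\<^sub>R z \<in> polydisc r"
proof -
  have "norm ((t *\<^sub>R z) $ j) \<le> 1 * norm (z $ j)" for j
    using assms(2) by (simp add: mult_left_le_one_le)
  then show ?thesis
    using assms(1) order_trans unfolding polydisc_def by fastforce
qed

lemma has_integral_monomial: "((\<lambda>t::real. t ^ n) has_integral 1 / real (n + 1)) {0..1}"
proof -
  have "((\<lambda>t. t ^ Suc n / real (Suc n)) has_vector_derivative t ^ n) (at t within {0..1})" for t :: real
    by (rule has_real_derivative_iff_has_vector_derivative[THEN iffD1])
      (rule derivative_eq_intros refl | simp del: of_nat_Suc power_Suc)+
  then show ?thesis
    using fundamental_theorem_of_calculus[of 0 1 "\<lambda>t. t ^ Suc n / real (Suc n)" "\<lambda>t. t ^ n"] by simp
qed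

text \<open>
  On a ray a monomial of degree \<open>d\<close> is a constant times \<open>t\<^sup>d\<close>, so integration over the unit interval
  divides its coefficient by \<open>d + 1\<close>.  The series converges uniformly on the ray, which justifies
  integration term by term.
\<close>

lemma radial_integral_exists:
  assumes f: "series_bounded r M f"
  shows "\<exists>g. series_bounded r M g \<and>
    (\<forall>z\<in>polydisc r. continuous_on {0..1} (\<lambda>t. f (t *\<^sub>R z)) \<and>
        ((\<lambda>t. f (t *\<^sub>R z)) has_integral g z) {0..1})"
proof -
  from f obtain c S where c: "((\<lambda>p. norm (c p) * r ^ total_degree p) has_sum S) UNIV" "S \<le> M"
    "\<And>z. z \<in> polydisc r \<Longrightarrow> ((\<lambda>p. c p * monom_at p z) has_sum f z) UNIV" and r: "0 < r"
    unfolding series_bounded_def by blast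
  define d where "d p = c p / of_nat (total_degree p + 1)" for p
  define g where "g z = (\<Sum>\<^sub>\<infinity>p. d p * monom_at p z)" for z
  have dc: "norm (d p) \<le> norm (c p)" for p
    using mult_left_mono[of 1 "real (total_degree p + 1)" "norm (c p)"] 
    by (simp add: d_def norm_divide divide_le_eq del: of_nat_add of_nat_Suc) 
  have le: "norm (d p) * r ^ total_degree p \<le> norm (c p) * r ^ total_degree p" for p
    using dc r by (intro mult_right_mono) auto
  have sd: "(\<lambda>p. norm (d p) * r ^ total_degree p) summable_on UNIV"
    by (rule summable_on_comparison_test[OF has_sum_imp_summable[OF c(1)]]) (use le r in auto)
  then obtain T where T: "((\<lambda>p. norm (d p) * r ^ total_degree p) has_sum T) UNIV"
    using has_sum_infsum by blast
  have "T \<le> S" by (rule has_sum_mono[OF T c(1)]) (use le in auto)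
  have dg: "((\<lambda>p. d p * monom_at p z) has_sum g z) UNIV" if "z \<in> polydisc r" for z
    unfolding g_def by (rule has_sum_infsum[OF abs_summable_summable[OF abs_summable_terms[OF sd that]]])
  have "series_bounded r M g"
    unfolding series_bounded_def using r T dg \<open>T \<le> S\<close> c(2) 
    by (intro conjI exI[of _ d] exI[of _ T]) auto
  moreover have "continuous_on {0..1} (\<lambda>t. f (t *\<^sub>R z)) \<and> ((\<lambda>t. f (t *\<^sub>R z)) has_integral g z) {0..1}"
    if z: "z \<in> polydisc r" for z
  proof -
    let ?F = "\<lambda>X t. \<Sum>p\<in>X. c p * monom_at p (t *\<^sub>R z)"
    have u: "uniform_limit {0..1} ?F (\<lambda>t. f (t *\<^sub>R z)) (finite_subsets_at_top UNIV)"
    proof (rule Weierstrass_m_test_general'[OF _ _ has_sum_imp_summable[OF c(1)]])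
      fix t :: real assume t: "t \<in> {0..1}"
      show "((\<lambda>p. c p * monom_at p (t *\<^sub>R z)) has_sum f (t *\<^sub>R z)) UNIV"
        by (rule c(3)[OF polydisc_scaleR[OF z t]])
      show "norm (c p * monom_at p (t *\<^sub>R z)) \<le> norm (c p) * r ^ total_degree p" for p
        by (simp add: norm_mult mult_left_mono norm_monom_at_le[OF polydisc_scaleR[OF z t]])
    qed
    have cont: "continuous_on {0..1} (?F X)" for X
      unfolding monom_at_scaleR by (intro continuous_intros)
    obtain I J where I: "\<And>X. (?F X has_integral I X) {0..1}" "((\<lambda>t. f (t *\<^sub>R z)) has_integral J) {0..1}"
      "(I \<longlongrightarrow> J) (finite_subsets_at_top UNIV)"
      by (rule uniform_limit_integral[OF u cont finite_subsets_at_top_neq_bot]) blast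
    have int_term: "((\<lambda>t. c p * monom_at p (t *\<^sub>R z)) has_integral d p * monom_at p z) {0..1}" for p
    proof -
      have "((\<lambda>t. complex_of_real (t ^ total_degree p)) has_integral 
              complex_of_real (1 / real (total_degree p + 1))) {0..1}"
        by (intro has_integral_of_real has_integral_monomial)
      then have "((\<lambda>t. c p * monom_at p z * complex_of_real (t ^ total_degree p)) has_integral 
              c p * monom_at p z * complex_of_real (1 / real (total_degree p + 1))) {0..1}"
        by (rule has_integral_mult_right)
      then show ?thesis
        by (simp add: monom_at_scaleR d_def mult_ac)
    qed
    have "I X = (\<Sum>p\<in>X. d p * monom_at p z)" if "finite X" for X
      by (rule has_integral_unique[OF I(1)]) (intro has_integral_sum that int_term)
    then have "\<forall>\<^sub>F X in finite_subsets_at_top UNIV. I X = (\<Sum>p\<in>X. d p * monom_at p z)"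
      by (intro eventually_finite_subsets_at_top_weakI) auto
    with I(3) have "((\<lambda>p. d p * monom_at p z) has_sum J) UNIV"
      unfolding has_sum_def by (rule Lim_transform_eventually)
    then have "J = g z" using dg[OF z] has_sum_unique by blast
    moreover have "continuous_on {0..1} (\<lambda>t. f (t *\<^sub>R z))"
      by (rule uniform_limit_theorem[OF _ u]) (auto simp: cont)
    ultimately show ?thesis using I(2) by simp
  qed
  ultimately show ?thesis by blast
qed

lemma continuous_on_radial:
  assumes "series_bounded r M f" "z \<in> polydisc r"
  shows "continuous_on {0..1} (\<lambda>t. f (t *\<^sub>R z))"
  using radial_integral_exists[OF assms(1)] assms(2) by blast

lemma series_bounded_radial_integral:
  assumes "series_bounded r M f"
  shows "series_bounded r M (\<lambda>z. integral {0..1} (\<lambda>t. f (t *\<^sub>R z)))"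
proof -
  from radial_integral_exists[OF assms] obtain g where g: "series_bounded r M g"
    "\<And>z. z \<in> polydisc r \<Longrightarrow> ((\<lambda>t. f (t *\<^sub>R z)) has_integral g z) {0..1}"
    by blast
  show ?thesis
    by (rule series_bounded_cong[OF g(1)]) (rule integral_unique[OF g(2), symmetric])
qed

text \<open>
  The substitution \<open>s = \<tau> t\<close> turns the expression into the integral of \<open>G\<close> from \<open>0\<close> to \<open>t\<close>.  This is how
  the radial integral equation yields the differential equation along rays.
\<close>

lemma has_vector_derivative_radial_integral:
  fixes G :: "real \<Rightarrow> 'a::banach"
  assumes G: "continuous_on {0..1} G" and t: "t \<in> {0..1}"
  shows "((\<lambda>t. t *\<^sub>R integral {0..1} (\<lambda>\<tau>. G (\<tau> * t))) has_vector_derivative G t) (at t within {0..1})"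
proof -
  have eq: "integral {0..s} G = s *\<^sub>R integral {0..1} (\<lambda>\<tau>. G (\<tau> * s))" if s: "s \<in> {0..1}" for s
  proof (cases "s = 0")
    case False
    with s have s': "0 < s" by simp
    have "G integrable_on {0..s}"
      using s by (intro integrable_continuous_real continuous_on_subset[OF G]) auto
    then have "(G has_integral integral {0..s} G) {0..s}" by (rule integrable_integral)
    from has_integral_stretch_real[OF this, of s] s'
    have "((\<lambda>\<tau>. G (s * \<tau>)) has_integral (1 / s) *\<^sub>R integral {0..s} G) ((\<lambda>x. x / s) ` {0..s})"
      by simp
    moreover have "(\<lambda>x. x / s) ` {0..s} = {0..1}"
      using s' by simp
    ultimately have "integral {0..1} (\<lambda>\<tau>. G (s * \<tau>)) = (1 / s) *\<^sub>R integral {0..s} G"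
      by (simp add: integral_unique)
    then show ?thesis using s' by (simp add: mult.commute)
  qed simp
  have "((\<lambda>s. integral {0..s} G) has_vector_derivative G t) (at t within {0..1})"
    by (rule integral_has_vector_derivative[OF G t])
  then show ?thesis
    by (rule has_vector_derivative_transform[OF t, rotated]) (simp add: eq)
qed

section \<open>First-order expansion\<close>

lemma monom_at_degree_0: "total_degree p = 0 \<Longrightarrow> monom_at p z = 1"
  by (simp add: total_degree_def monom_at_def)

lemma monom_at_zero:
  assumes "total_degree p \<noteq> 0"
  shows "monom_at p 0 = 0"
proof -
  from assms obtain j where "fst p j + snd p j \<noteq> 0"
    unfolding total_degree_def by (rule sum.not_neutral_contains_not_neutral)
  then have "((0::complex) ^ fst p j * cnj 0 ^ snd p j) = 0"
    by (auto simp: power_0_left)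
  then show ?thesis
    unfolding monom_at_def zero_index by (intro prod_zero) auto
qed

lemma monom_at_degree_1:
  assumes "total_degree p = 1"
  obtains j where "monom_at p = (\<lambda>z. z $ j)" | j where "monom_at p = (\<lambda>z. cnj (z $ j))"
proof -
  have "\<exists>j\<in>UNIV. fst p j + snd p j = Suc 0 \<and> (\<forall>i\<in>UNIV. j \<noteq> i \<longrightarrow> fst p i + snd p i = 0)"
    by (rule sum_eq_Suc0_iff[THEN iffD1]) (use assms in \<open>simp_all add: total_degree_def\<close>)
  then obtain j where j: "fst p j + snd p j = 1" "\<And>i. i \<noteq> j \<Longrightarrow> fst p i + snd p i = 0"
    by auto
  have "monom_at p z = (z $ j) ^ fst p j * cnj (z $ j) ^ snd p j" for z
    unfolding monom_at_def using j(2) by (subst prod.remove[of _ j]) auto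
  moreover have "fst p j = 1 \<and> snd p j = 0 \<or> fst p j = 0 \<and> snd p j = 1"
    using j(1) by linarith
  ultimately have "monom_at p = (\<lambda>z. z $ j) \<or> monom_at p = (\<lambda>z. cnj (z $ j))"
    by (auto simp: fun_eq_iff)
  then show ?thesis using that by blast
qed

lemma in_polydisc_of_norm: "norm z \<le> r \<Longrightarrow> z \<in> polydisc r"
  by (auto simp: polydisc_def intro: order_trans[OF Finite_Cartesian_Product.norm_nth_le])

text \<open>
  \<open>L\<close> collects the terms of degree one.  For \<open>|s| \<le> \<rho>\<close> the terms of degree at least two gain the
  factor \<open>(|s| / \<rho>)\<^sup>2\<close> over their weight in the norm.
\<close>

lemma series_bounded_taylor:
  fixes f :: "complex ^ 'k::finite \<Rightarrow> complex"
  assumes f: "series_bounded \<rho> M f"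
  shows "\<exists>L. bounded_linear L \<and> (\<forall>s. norm (L s) \<le> M * (norm s / \<rho>)) \<and>
           (\<forall>s. norm s \<le> \<rho> \<longrightarrow> norm (f s - f 0 - L s) \<le> M * (norm s / \<rho>)\<^sup>2)"
proof -
  from f obtain c S where c: "((\<lambda>p. norm (c p) * \<rho> ^ total_degree p) has_sum S) UNIV" "S \<le> M"
    "\<And>z. z \<in> polydisc \<rho> \<Longrightarrow> ((\<lambda>p. c p * monom_at p z) has_sum f z) UNIV" and \<rho>: "0 < \<rho>"
    unfolding series_bounded_def by blast
  define l where "l p s = (if total_degree p = 1 then monom_at p s else 0)" for p :: "'k bidegree" and s
  have l_linear: "l p (s + t) = l p s + l p t \<and> l p (x *\<^sub>R s) = x *\<^sub>R l p s" for p s t x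
  proof (cases "total_degree p = 1")
    case True
    then show ?thesis by (cases rule: monom_at_degree_1) (simp_all add: l_def True)
  qed (simp add: l_def)
  have l_le: "norm (c p * l p s) \<le> norm (c p) * \<rho> ^ total_degree p * (norm s / \<rho>)" for p s
  proof (cases "total_degree p = 1")
    case True
    then have "norm (l p s) \<le> norm s"
      by (cases rule: monom_at_degree_1) (simp_all add: l_def True Finite_Cartesian_Product.norm_nth_le)
    then have "norm (c p) * norm (l p s) \<le> norm (c p) * norm s"
      by (intro mult_left_mono) auto
    with True \<rho> show ?thesis by (simp add: norm_mult)
  qed (use \<rho> in \<open>simp add: l_def\<close>)
  have bound: "((\<lambda>p. norm (c p) * \<rho> ^ total_degree p * x) has_sum S * x) UNIV" for x
    by (rule has_sum_cmult_left[OF c(1)])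
  define L where "L s = (\<Sum>\<^sub>\<infinity>p. c p * l p s)" for s
  have L: "((\<lambda>p. c p * l p s) has_sum L s) UNIV" for s
  proof -
    have "(\<lambda>p. norm (c p * l p s)) summable_on UNIV"
      by (rule Infinite_Sum.abs_summable_on_comparison_test'[OF has_sum_imp_summable[OF bound] l_le])
    then show ?thesis
      unfolding L_def by (rule has_sum_infsum[OF abs_summable_summable])
  qed
  have norm_le: "norm a \<le> M * x" 
    if "(h has_sum a) UNIV" "\<And>p. norm (h p) \<le> norm (c p) * \<rho> ^ total_degree p * x" "0 \<le> x" 
    for h :: "'k bidegree \<Rightarrow> complex" and a x
  proof -
    have "(\<lambda>p. norm (h p)) summable_on UNIV"
      by (rule Infinite_Sum.abs_summable_on_comparison_test'[OF has_sum_imp_summable[OF bound] that(2)])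
    then obtain T where T: "((\<lambda>p. norm (h p)) has_sum T) UNIV" using has_sum_infsum by blast
    have "norm a \<le> T" by (rule norm_has_sum_bound[OF T that(1)])
    also have "T \<le> S * x" by (rule has_sum_mono[OF T bound that(2)])
    also have "\<dots> \<le> M * x" using c(2) that(3) by (rule mult_right_mono)
    finally show ?thesis .
  qed
  have L_le: "norm (L s) \<le> M * (norm s / \<rho>)" for s
    by (rule norm_le[OF L l_le]) (use \<rho> in simp)
  have "bounded_linear L"
  proof (rule bounded_linear_intro[where K = "M / \<rho>"])
    show "L (s + t) = L s + L t" for s t
      using has_sum_unique[OF L[of "s + t"]] has_sum_add[OF L[of s] L[of t]] 
      by (simp add: l_linear distrib_left)
    show "L (x *\<^sub>R s) = x *\<^sub>R L s" for x s
    proof (rule has_sum_unique[OF L])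
      have eq: "c p * l p (x *\<^sub>R s) = of_real x * (c p * l p s)" for p
        using l_linear[of p] by (simp add: scaleR_conv_of_real[where 'a = complex])
      show "((\<lambda>p. c p * l p (x *\<^sub>R s)) has_sum x *\<^sub>R L s) UNIV"
        unfolding eq scaleR_conv_of_real[where 'a = complex] by (rule has_sum_cmult_right[OF L])
    qed
    show "norm (L s) \<le> norm s * (M / \<rho>)" for s
      using L_le[of s] by (simp add: mult_ac)
  qed
  moreover have "norm (f s - f 0 - L s) \<le> M * (norm s / \<rho>)\<^sup>2" if s: "norm s \<le> \<rho>" for s
  proof (rule norm_le)
    have "((\<lambda>p. c p * monom_at p s + - (c p * monom_at p 0) + - (c p * l p s)) 
        has_sum f s + - f 0 + - L s) UNIV"
      using s \<rho> by (intro has_sum_add has_sum_uminusI c(3) L in_polydisc_of_norm) auto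
    then show "((\<lambda>p. c p * (monom_at p s - monom_at p 0 - l p s)) has_sum f s - f 0 - L s) UNIV"
      by (simp add: algebra_simps)
    show "0 \<le> (norm s / \<rho>)\<^sup>2" by simp
    show "norm (c p * (monom_at p s - monom_at p 0 - l p s)) \<le> 
      norm (c p) * \<rho> ^ total_degree p * (norm s / \<rho>)\<^sup>2" for p
    proof -
      consider "total_degree p = 0" | "total_degree p = 1" | "2 \<le> total_degree p" by linarith
      then have "norm (monom_at p s - monom_at p 0 - l p s) \<le> \<rho> ^ total_degree p * (norm s / \<rho>)\<^sup>2"
      proof cases
        case 3
        have "norm (monom_at p s) \<le> norm s ^ total_degree p"
          by (rule norm_monom_at_le[OF in_polydisc_of_norm]) simp
        also have "\<dots> = \<rho> ^ total_degree p * (norm s / \<rho>) ^ total_degree p"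
          using \<rho> by (simp add: power_divide)
        also have "\<dots> \<le> \<rho> ^ total_degree p * (norm s / \<rho>)\<^sup>2"
          using 3 s \<rho> by (intro mult_left_mono power_decreasing) auto
        finally show ?thesis
          using 3 by (simp add: monom_at_zero l_def)
      qed (use \<rho> in \<open>simp_all add: l_def monom_at_zero monom_at_degree_0\<close>)
      then show ?thesis by (simp add: norm_mult mult_left_mono mult.assoc)
    qed
  qed
  ultimately show ?thesis using L_le by blast
qed

text \<open>
  Expansion at another centre \<open>p\<close> with bounds uniform in \<open>p\<close>: composing with the translation
  \<open>s \<mapsto> p + s\<close> shows that the recentred function is again a bounded series.
\<close>

lemma series_bounded_taylor_at:
  fixes f :: "complex ^ 'k::finite \<Rightarrow> complex"
  assumes f: "series_bounded (2 * \<rho>) M f" and p: "p \<in> polydisc \<rho>"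
  shows "\<exists>L. bounded_linear L \<and> (\<forall>s. norm (L s) \<le> M * (norm s / \<rho>)) \<and>
           (\<forall>s. norm s \<le> \<rho> \<longrightarrow> norm (f (p + s) - f p - L s) \<le> M * (norm s / \<rho>)\<^sup>2)"
proof -
  have \<rho>: "0 < \<rho>" using series_bounded_pos[OF f] by simp
  have "series_bounded \<rho> M (\<lambda>s. f (p + s))"
  proof (rule series_bounded_compose[OF f \<rho>])
    fix i
    have "norm (p $ i) \<le> \<rho>" using p by (simp add: polydisc_def)
    then show "series_bounded \<rho> (2 * \<rho>) (\<lambda>s. (p + s) $ i)"
      using series_bounded_mono[OF series_bounded_add[OF series_bounded_const[OF \<rho>, of "p $ i"]
            series_bounded_coord[OF \<rho>, of i]]] by simp
  qed
  from series_bounded_taylor[OF this] show ?thesis by simp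
qed

lemma series_bounded_lipschitz:
  fixes f :: "complex ^ 'k::finite \<Rightarrow> complex"
  assumes f: "series_bounded (2 * \<rho>) M f" and p: "p \<in> polydisc \<rho>" and s: "norm s \<le> \<rho>"
  shows "norm (f (p + s) - f p) \<le> 2 * M / \<rho> * norm s"
proof -
  have \<rho>: "0 < \<rho>" using series_bounded_pos[OF f] by simp
  have M: "0 \<le> M" by (rule series_bounded_nonneg[OF f])
  obtain L where L: "norm (L s) \<le> M * (norm s / \<rho>)" "norm (f (p + s) - f p - L s) \<le> M * (norm s / \<rho>)\<^sup>2"
    using series_bounded_taylor_at[OF f p] s by blast
  have "(norm s / \<rho>)\<^sup>2 \<le> norm s / \<rho>"
    using s \<rho> power_decreasing[of 1 2 "norm s / \<rho>"] by simp
  then have "M * (norm s / \<rho>)\<^sup>2 \<le> M * (norm s / \<rho>)"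
    using M by (rule mult_left_mono)
  moreover have "norm (f (p + s) - f p) \<le> norm (f (p + s) - f p - L s) + norm (L s)"
    using norm_triangle_ineq[of "f (p + s) - f p - L s" "L s"] by simp
  ultimately have "norm (f (p + s) - f p) \<le> 2 * (M * (norm s / \<rho>))" using L by linarith
  then show ?thesis by simp
qed

section \<open>R-holomorphic functions as bounded series\<close>

lemma norm_vec_le_card:
  fixes z :: "complex ^ 'k::finite"
  assumes "\<And>j. norm (z $ j) \<le> r"
  shows "norm z \<le> real CARD('k) * r"
proof -
  have "norm z \<le> (\<Sum>j\<in>UNIV. norm (z $ j))"
    unfolding norm_vec_def by (rule L2_set_le_sum) simp
  also have "\<dots> \<le> (\<Sum>j\<in>(UNIV::'k set). r)"
    using assms by (intro sum_mono) simp
  finally show ?thesis by simp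
qed

text \<open>
  Absolute convergence at the single point all of whose coordinates are \<open>a\<^sub>j + r\<close> is exactly
  finiteness of the weighted coefficient sum with radius \<open>r\<close>.
\<close>

lemma series_bounded_of_R_holomorphic:
  fixes g :: "complex ^ 'k::finite \<Rightarrow> complex"
  assumes "R_holomorphic_at D g a"
  obtains r M where "0 < r" "\<And>x. 0 < x \<Longrightarrow> x \<le> r \<Longrightarrow> series_bounded x M (\<lambda>s. g (a + s))"
    "\<And>s. s \<in> polydisc r \<Longrightarrow> a + s \<in> D"
proof -
  from assms obtain U and c :: "('k \<Rightarrow> nat) \<Rightarrow> ('k \<Rightarrow> nat) \<Rightarrow> complex" where U: "open U" "a \<in> U" "U \<subseteq> D"
    and sm: "\<And>z. z \<in> U \<Longrightarrow>
           (\<lambda>(k, l). norm (c k l * (\<Prod>j\<in>UNIV. (z $ j - a $ j) ^ k j * (cnj (z $ j) - cnj (a $ j)) ^ l j)))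
             summable_on UNIV"
    and hs: "\<And>z. z \<in> U \<Longrightarrow>
           ((\<lambda>(k, l). c k l * (\<Prod>j\<in>UNIV. (z $ j - a $ j) ^ k j * (cnj (z $ j) - cnj (a $ j)) ^ l j))
             has_sum g z) UNIV"
    unfolding R_holomorphic_at_def by blast
  have sm': "(\<lambda>p. norm (c (fst p) (snd p) * monom_at p s)) summable_on UNIV"
    and hs': "((\<lambda>p. c (fst p) (snd p) * monom_at p s) has_sum g (a + s)) UNIV" if "a + s \<in> U" for s
    using sm[OF that] hs[OF that] by (simp_all add: case_prod_unfold monom_at_def)
  from U obtain e where e: "0 < e" "ball a e \<subseteq> U" by (meson openE)
  define r where "r = e / (2 * real CARD('k))"
  have r: "0 < r" using e(1) by (simp add: r_def)
  have inU: "a + s \<in> U" if "s \<in> polydisc r" for s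
  proof -
    have "norm s \<le> e / 2" using norm_vec_le_card[of s r] that by (simp add: r_def polydisc_def)
    then show ?thesis using e by (auto simp: subset_iff dist_norm)
  qed
  \<comment> \<open>At this point every monomial attains the bound \<open>r ^ total_degree p\<close>.\<close>
  define s0 :: "complex ^ 'k" where "s0 = (\<chi> j. of_real r)"
  have "s0 \<in> polydisc r" using r by (simp add: s0_def polydisc_def)
  moreover have "norm (monom_at p s0) = r ^ total_degree p" for p
    using r by (simp add: s0_def monom_at_def total_degree_def norm_mult norm_power prod_norm[symmetric] power_add power_sum)
  ultimately have "(\<lambda>p. norm (c (fst p) (snd p)) * r ^ total_degree p) summable_on UNIV"
    using sm'[OF inU, of s0] by (simp add: norm_mult)
  then obtain S where S: "((\<lambda>p. norm (c (fst p) (snd p)) * r ^ total_degree p) has_sum S) UNIV"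
    using has_sum_infsum by blast
  have "series_bounded x S (\<lambda>s. g (a + s))" if x: "0 < x" "x \<le> r" for x
  proof -
    have le: "norm (c (fst p) (snd p)) * x ^ total_degree p \<le> norm (c (fst p) (snd p)) * r ^ total_degree p" for p
      using x by (intro mult_left_mono power_mono) auto
    have "(\<lambda>p. norm (c (fst p) (snd p)) * x ^ total_degree p) summable_on UNIV"
      by (rule summable_on_comparison_test[OF has_sum_imp_summable[OF S] le]) (use x in simp)
    then obtain T where T: "((\<lambda>p. norm (c (fst p) (snd p)) * x ^ total_degree p) has_sum T) UNIV"
      using has_sum_infsum by blast
    have "T \<le> S" by (rule has_sum_mono[OF T S le])
    moreover have "polydisc x \<subseteq> polydisc r" using x(2) by (auto simp: polydisc_def intro: order_trans)
    ultimately show ?thesis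
      unfolding series_bounded_def using x T inU hs'
      by (intro conjI exI[of _ "\<lambda>p. c (fst p) (snd p)"] exI[of _ T]) auto
  qed
  then show ?thesis using that r inU U(3) by blast
qed

lemma R_holomorphic_of_series_bounded:
  fixes g :: "complex ^ 'k::finite \<Rightarrow> complex"
  assumes "series_bounded r M (\<lambda>s. g (a + s))" "ball a r \<subseteq> D"
  shows "R_holomorphic_at D g a"
proof -
  from assms(1) obtain c S where c: "((\<lambda>p. norm (c p) * r ^ total_degree p) has_sum S) UNIV"
    "\<And>s. s \<in> polydisc r \<Longrightarrow> ((\<lambda>p. c p * monom_at p s) has_sum g (a + s)) UNIV" and r: "0 < r"
    unfolding series_bounded_def by blast
  have "(\<lambda>(k, l). norm (c (k, l) * (\<Prod>j\<in>UNIV. (z $ j - a $ j) ^ k j * (cnj (z $ j) - cnj (a $ j)) ^ l j)))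
             summable_on UNIV \<and>
        ((\<lambda>(k, l). c (k, l) * (\<Prod>j\<in>UNIV. (z $ j - a $ j) ^ k j * (cnj (z $ j) - cnj (a $ j)) ^ l j))
             has_sum g z) UNIV" if "z \<in> ball a r" for z
  proof -
    have "z - a \<in> polydisc r"
      using that by (intro in_polydisc_of_norm) (simp add: dist_norm norm_minus_commute)
    then show ?thesis
      using abs_summable_terms[OF has_sum_imp_summable[OF c(1)], of "z - a"] c(2)[of "z - a"]
      by (simp add: case_prod_unfold monom_at_def)
  qed
  then show ?thesis
    unfolding R_holomorphic_at_def using r assms(2)
    by (intro exI[of _ "ball a r"] exI[of _ "\<lambda>k l. c (k, l)"]) auto
qed

lemma common_series_bound:
  fixes X :: "'n::finite \<Rightarrow> 'l::finite \<Rightarrow> complex ^ 'k::finite \<Rightarrow> complex"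
  assumes X: "\<And>\<xi> l. R_holomorphic_at G (X \<xi> l) P"
  obtains \<rho> M where "0 < \<rho>" "0 < M"
    "\<And>\<xi> l x. 0 < x \<Longrightarrow> x \<le> 2 * \<rho> \<Longrightarrow> series_bounded x M (\<lambda>s. X \<xi> l (P + s))"
    "\<And>s. s \<in> polydisc (2 * \<rho>) \<Longrightarrow> P + s \<in> G"
proof -
  define Q where "Q i r M \<longleftrightarrow> 0 < r \<and> (\<forall>x. 0 < x \<longrightarrow> x \<le> r \<longrightarrow> series_bounded x M (\<lambda>s. X (fst i) (snd i) (P + s))) \<and>
     (\<forall>s\<in>polydisc r. P + s \<in> G)" for i r M
  have "\<exists>r M. Q i r M" for i
    by (rule series_bounded_of_R_holomorphic[OF X[of "fst i" "snd i"]]) (auto simp: Q_def)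
  then obtain r M where rM: "\<And>i. Q i (r i) (M i)" by metis
  define R where "R = Min (range r)"
  define B where "B = max 1 (Max (range M))"
  have R: "R \<le> r i" for i unfolding R_def by simp
  have R0: "0 < R" unfolding R_def using rM by (simp add: Q_def)
  have "M i \<le> B" for i unfolding B_def by (simp add: le_max_iff_disj)
  then have B: "series_bounded x B (\<lambda>s. X \<xi> l (P + s))" if "0 < x" "x \<le> R" for x \<xi> l
    using rM[of "(\<xi>, l)"] that R[of "(\<xi>, l)"] series_bounded_mono unfolding Q_def by fastforce
  have G: "P + s \<in> G" if "s \<in> polydisc R" for s
  proof -
    obtain i :: "'n \<times> 'l" where True by blast
    have "s \<in> polydisc (r i)" using that R[of i] by (auto simp: polydisc_def intro: order_trans)
    then show ?thesis using rM[of i] by (simp add: Q_def)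
  qed
  show ?thesis
    by (rule that[of "R / 2" B]) (use R0 B G in \<open>auto simp: B_def\<close>)
qed

section \<open>Contractions in the norm of the series\<close>

text \<open>
  Banach's fixed point theorem for the norm of \<open>series_bounded\<close>.  Successive iterates differ by at most
  \<open>\<rho> / 2^(n + 1)\<close>, so the limit is the sum of an absolutely convergent series of series; halving the
  bound at the start keeps the whole iteration in the ball of radius \<open>\<rho>\<close>.
\<close>

lemma series_bounded_fixed_point:
  fixes T :: "(complex ^ 'm::finite \<Rightarrow> complex ^ 'n::finite) \<Rightarrow> complex ^ 'm \<Rightarrow> complex ^ 'n"
  assumes T0: "\<And>\<xi>. series_bounded r (\<rho> / 2) (\<lambda>z. T (\<lambda>_. 0) z $ \<xi>)"
    and contr: "\<And>u v \<epsilon> \<xi>. \<lbrakk>\<And>\<xi>. series_bounded r \<rho> (\<lambda>z. u z $ \<xi>); \<And>\<xi>. series_bounded r \<rho> (\<lambda>z. v z $ \<xi>);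
        \<And>\<xi>. series_bounded r \<epsilon> (\<lambda>z. u z $ \<xi> - v z $ \<xi>)\<rbrakk> \<Longrightarrow>
        series_bounded r (\<epsilon> / 2) (\<lambda>z. T u z $ \<xi> - T v z $ \<xi>)"
  obtains u where "\<And>\<xi>. series_bounded r \<rho> (\<lambda>z. u z $ \<xi>)" "\<And>z. z \<in> polydisc r \<Longrightarrow> u z = T u z"
proof -
  have r: "0 < r" using series_bounded_pos[OF T0] .
  have \<rho>: "0 \<le> \<rho>" using series_bounded_nonneg[OF T0] by simp
  note zero = series_bounded_zero[OF r \<rho>]
  define I where "I n = (T ^^ n) (\<lambda>_. 0)" for n
  have I_Suc: "I (Suc n) = T (I n)" for n by (simp add: I_def)
  have I_0: "I 0 = (\<lambda>_. 0)" by (simp add: I_def)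
  have I_ball: "series_bounded r \<rho> (\<lambda>z. I n z $ \<xi>)" for n \<xi>
  proof (induction n arbitrary: \<xi>)
    case 0
    then show ?case using zero by (simp add: I_0)
  next
    case (Suc n)
    have "series_bounded r (\<rho> / 2) (\<lambda>z. T (I n) z $ \<xi> - T (\<lambda>_. 0) z $ \<xi>)"
      by (rule contr) (use Suc zero in simp_all)
    from series_bounded_add[OF this T0[of \<xi>]] show ?case by (simp add: I_Suc)
  qed
  have I_diff: "series_bounded r (\<rho> * (1 / 2) ^ Suc n) (\<lambda>z. I (Suc n) z $ \<xi> - I n z $ \<xi>)" for n \<xi>
  proof (induction n arbitrary: \<xi>)
    case 0
    then show ?case using T0 by (simp add: I_0 I_Suc)
  next
    case (Suc n)
    have "series_bounded r (\<rho> * (1 / 2) ^ Suc n / 2) (\<lambda>z. T (I (Suc n)) z $ \<xi> - T (I n) z $ \<xi>)"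
      by (rule contr[OF I_ball I_ball Suc])
    then show ?case by (simp add: I_Suc)
  qed
  have geom: "((\<lambda>k. \<rho> * (1 / 2) ^ Suc (n + k)) has_sum \<rho> * (1 / 2) ^ n) UNIV" for n
  proof -
    have "((\<lambda>k. (1 / 2 :: real) ^ k) has_sum 2) (UNIV :: nat set)"
      using sums_nonneg_imp_has_sum[of "\<lambda>k. (1 / 2 :: real) ^ k" 2] geometric_sums[of "1 / 2 :: real"] by simp
    from has_sum_cmult_right[OF this, of "\<rho> * (1 / 2) ^ Suc n"] show ?thesis
      by (simp add: power_add mult_ac)
  qed
  define u where "u z = (\<chi> \<xi>. \<Sum>\<^sub>\<infinity>k. I (Suc k) z $ \<xi> - I k z $ \<xi>)" for z
  have u: "((\<lambda>k. I (Suc k) z $ \<xi> - I k z $ \<xi>) has_sum u z $ \<xi>) UNIV" if z: "z \<in> polydisc r" for z \<xi>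
  proof -
    have le: "norm (I (Suc k) z $ \<xi> - I k z $ \<xi>) \<le> \<rho> * (1 / 2) ^ Suc (0 + k)" for k
      using series_bounded_norm_le[OF I_diff z] by simp
    have "(\<lambda>k. norm (I (Suc k) z $ \<xi> - I k z $ \<xi>)) summable_on UNIV"
      by (rule Infinite_Sum.abs_summable_on_comparison_test'[OF has_sum_imp_summable[OF geom[of 0]] le])
    then show ?thesis
      unfolding u_def vec_lambda_beta by (rule has_sum_infsum[OF abs_summable_summable])
  qed
  have u_I: "series_bounded r (\<rho> * (1 / 2) ^ n) (\<lambda>z. u z $ \<xi> - I n z $ \<xi>)" for n \<xi>
  proof (rule series_bounded_infsum[OF r I_diff geom])
    fix z :: "complex ^ 'm" assume z: "z \<in> polydisc r"
    have tel: "(\<Sum>k<n. I (Suc k) z $ \<xi> - I k z $ \<xi>) = I n z $ \<xi>"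
      using sum_lessThan_telescope[of "\<lambda>k. I k z $ \<xi>" n] by (simp add: I_0)
    have "((\<lambda>k. I (Suc k) z $ \<xi> - I k z $ \<xi>) has_sum (u z $ \<xi> - I n z $ \<xi>)) (UNIV - {..<n})"
      by (rule has_sum_Diff[OF u[OF z]]) (simp_all add: tel has_sum_finite_iff)
    moreover have "bij_betw (\<lambda>k. n + k) UNIV (UNIV - {..<n})"
      by (rule bij_betwI[where g = "\<lambda>k. k - n"]) auto
    ultimately show "((\<lambda>k. I (Suc (n + k)) z $ \<xi> - I (n + k) z $ \<xi>) has_sum (u z $ \<xi> - I n z $ \<xi>)) UNIV"
      using has_sum_reindex_bij_betw[of "\<lambda>k. n + k" UNIV "UNIV - {..<n}"
          "\<lambda>k. I (Suc k) z $ \<xi> - I k z $ \<xi>"] by simp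
  qed
  have u_ball: "series_bounded r \<rho> (\<lambda>z. u z $ \<xi>)" for \<xi>
    using u_I[of 0] by (simp add: I_0)
  have "u z = T u z" if z: "z \<in> polydisc r" for z
  proof -
    have "u z $ \<xi> - T u z $ \<xi> = 0" for \<xi>
    proof -
      have "norm (u z $ \<xi> - T u z $ \<xi>) \<le> \<rho> * (1 / 2) ^ n" for n
      proof -
        have "series_bounded r (\<rho> * (1 / 2) ^ n / 2) (\<lambda>z. T u z $ \<xi> - T (I n) z $ \<xi>)"
          by (rule contr[OF u_ball I_ball u_I])
        from series_bounded_diff[OF u_I[of "Suc n" \<xi>] this]
        have "series_bounded r (\<rho> * (1 / 2) ^ n) (\<lambda>z. u z $ \<xi> - T u z $ \<xi>)"
          by (simp add: I_Suc)
        then show ?thesis by (rule series_bounded_norm_le[OF _ z])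
      qed
      moreover have "(\<lambda>n. \<rho> * (1 / 2) ^ n) \<longlonglongrightarrow> \<rho> * 0"
        by (intro tendsto_intros LIMSEQ_power_zero) simp
      ultimately have "norm (u z $ \<xi> - T u z $ \<xi>) \<le> \<rho> * 0"
        by (intro LIMSEQ_le_const) auto
      then show ?thesis by simp
    qed
    then show ?thesis by (simp add: vec_eq_iff)
  qed
  with u_ball show ?thesis by (rule that)
qed

section \<open>Pfaffian forms, Wirtinger derivatives and the Frobenius symmetry\<close>

text \<open>
  The right-hand side of the system at a given point: \<open>c\<close> is the array of coefficients of \<open>dz\<^sub>j\<close> and its
  conjugate, \<open>h\<close> the increment of \<open>z\<close>.
\<close>

definition pfaff :: "('n::finite \<Rightarrow> 'm::finite + 'm \<Rightarrow> complex) \<Rightarrow> complex ^ 'm \<Rightarrow> complex ^ 'n" where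
  "pfaff c h = (\<chi> \<xi>. \<Sum>j\<in>UNIV. c \<xi> (Inl j) * h $ j + c \<xi> (Inr j) * cnj (h $ j))"

lemma norm_pfaff_le:
  fixes c :: "'n::finite \<Rightarrow> 'm::finite + 'm \<Rightarrow> complex"
  assumes c: "\<And>\<xi> l. norm (c \<xi> l) \<le> B"
  shows "norm (pfaff c h) \<le> real (2 * CARD('n) * CARD('m)) * B * norm h"
proof -
  have B: "0 \<le> B" using c norm_ge_zero order_trans by blast
  have "norm (pfaff c h $ \<xi>) \<le> real CARD('m) * (2 * B * norm h)" for \<xi>
  proof -
    have "norm (pfaff c h $ \<xi>) \<le> (\<Sum>j\<in>(UNIV :: 'm set). 2 * B * norm h)"
      unfolding pfaff_def vec_lambda_beta
    proof (rule sum_norm_le)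
      fix j
      have h: "norm (h $ j) \<le> norm h" by (rule Finite_Cartesian_Product.norm_nth_le)
      have le: "norm (c \<xi> l) * norm (h $ j) \<le> B * norm h" for l
        by (rule mult_mono[OF c h B norm_ge_zero])
      have "norm (c \<xi> (Inl j) * h $ j + c \<xi> (Inr j) * cnj (h $ j)) \<le> B * norm h + B * norm h"
        by (rule order_trans[OF norm_triangle_ineq])
          (unfold norm_mult complex_mod_cnj, rule add_mono[OF le le])
      then show "norm (c \<xi> (Inl j) * h $ j + c \<xi> (Inr j) * cnj (h $ j)) \<le> 2 * B * norm h" by simp
    qed
    then show ?thesis by simp
  qed
  from norm_vec_le_card[OF this] show ?thesis by (simp add: mult_ac)
qed

lemma bounded_linear_pfaff: 
  fixes c :: "'n::finite \<Rightarrow> 'm::finite + 'm \<Rightarrow> complex"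
  shows "bounded_linear (pfaff c)"
proof -
  define B where "B = Max (range (\<lambda>(\<xi>, l). norm (c \<xi> l)))"
  have "norm (c \<xi> l) \<le> B" for \<xi> l
    unfolding B_def by (rule Max_ge) (auto simp: image_iff intro!: exI[of _ "(\<xi>, l)"])
  then have bound: "norm (pfaff c h) \<le> real (2 * CARD('n) * CARD('m)) * B * norm h" for h
    by (rule norm_pfaff_le)
  show ?thesis
  proof (rule bounded_linear_intro)
    show "pfaff c (h + k) = pfaff c h + pfaff c k" for h k
      by (simp add: pfaff_def vec_eq_iff distrib_left sum.distrib algebra_simps)
    show "pfaff c (x *\<^sub>R h) = x *\<^sub>R pfaff c h" for x h
      by (simp add: pfaff_def vec_eq_iff scaleR_right.sum scaleR_add_right)
    show "norm (pfaff c h) \<le> norm h * (real (2 * CARD('n) * CARD('m)) * B)" for h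
      using bound[of h] by (simp only: mult_ac)
  qed
qed

lemma pfaff_diff: "pfaff c h - pfaff d h = pfaff (\<lambda>\<xi> l. c \<xi> l - d \<xi> l) h"
  by (simp add: pfaff_def vec_eq_iff left_diff_distrib sum_subtractf sum.distrib algebra_simps)

lemma has_derivative_vec:
  fixes f :: "'a::real_normed_vector \<Rightarrow> complex ^ 'n::finite"
  assumes "\<And>i. ((\<lambda>x. f x $ i) has_derivative (\<lambda>h. f' h $ i)) (at x within S)"
  shows "(f has_derivative f') (at x within S)"
proof -
  have expand: "v = (\<Sum>i\<in>UNIV. axis i (v $ i))" for v :: "complex ^ 'n"
    by (simp add: vec_eq_iff axis_def)
  have "bounded_linear (axis i :: complex \<Rightarrow> complex ^ 'n)" for i
  proof (rule bounded_linear_intro)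
    show "norm (axis i x :: complex ^ 'n) \<le> norm x * real CARD('n)" for x
      unfolding mult.commute[of "norm x"] by (rule norm_vec_le_card) (simp add: axis_def)
  qed (simp_all add: vec_eq_iff axis_def)
  then have "((\<lambda>x. \<Sum>i\<in>UNIV. axis i (f x $ i)) has_derivative (\<lambda>h. \<Sum>i\<in>UNIV. axis i (f' h $ i))) (at x within S)"
    by (intro has_derivative_sum) (rule bounded_linear.has_derivative[OF _ assms])
  then show ?thesis unfolding expand[symmetric] .
qed

lemma sum_UNIV_Plus:
  "(\<Sum>i\<in>(UNIV :: ('m::finite + 'n::finite) set). f i) = (\<Sum>j\<in>UNIV. f (Inl j)) + (\<Sum>\<xi>\<in>UNIV. f (Inr \<xi>))"
  by (subst UNIV_Plus_UNIV[symmetric], subst sum.Plus) simp_all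

lemma join_nth [simp]: "join z w $ Inl j = z $ j" "join z w $ Inr \<xi> = w $ \<xi>"
  by (simp_all add: join_def)

lemma vec_sum_eq_iff: "(p :: 'a ^ ('m::finite + 'n::finite)) = q \<longleftrightarrow> (\<forall>j. p $ Inl j = q $ Inl j) \<and> (\<forall>\<xi>. p $ Inr \<xi> = q $ Inr \<xi>)"
proof -
  have "(\<forall>i. p $ i = q $ i) \<longleftrightarrow> (\<forall>j. p $ Inl j = q $ Inl j) \<and> (\<forall>\<xi>. p $ Inr \<xi> = q $ Inr \<xi>)"
    by (rule split_sum_all)
  then show ?thesis by (simp only: vec_eq_iff)
qed

lemma join_add: "join (z + z') (w + w') = join z w + join z' w'"
  and join_diff: "join (z - z') (w - w') = join z w - join z' w'"
  and join_scaleR: "join (t *\<^sub>R z) (t *\<^sub>R w) = t *\<^sub>R join z w"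
  by (simp_all add: vec_sum_eq_iff)

lemma norm_join: "norm (join z w) = norm (z, w)"
  by (simp add: norm_vec_def L2_set_def norm_Pair sum_UNIV_Plus sum_nonneg)

text \<open>
  The operators of the system are built from the formal derivatives, while the estimates use the real
  Frechet derivative; this identity translates between them.
\<close>

lemma has_derivative_eq_wirtinger:
  assumes f: "(f has_derivative L) (at p)"
  shows "L v = (\<Sum>i\<in>UNIV. v $ i * wirt i f p + cnj (v $ i) * wirt_bar i f p)"
proof -
  have lin: "linear L" using f has_derivative_linear by blast
  have dd: "dir_deriv w f p = L w" for w
  proof -
    have "((\<lambda>t. p + t *\<^sub>R w) has_derivative (\<lambda>t. t *\<^sub>R w)) (at 0)"
      by (auto intro!: derivative_eq_intros)
    moreover have "(f has_derivative L) (at (p + 0 *\<^sub>R w))" using f by simp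
    ultimately have "((\<lambda>t. f (p + t *\<^sub>R w)) has_derivative (\<lambda>t. L (t *\<^sub>R w))) (at 0)"
      by (rule has_derivative_compose)
    then have "((\<lambda>t. f (p + t *\<^sub>R w)) has_vector_derivative L w) (at 0)"
      by (simp add: has_vector_derivative_def linear_scale[OF lin])
    then show ?thesis unfolding dir_deriv_def by (rule vector_derivative_at)
  qed
  have "v = (\<Sum>i\<in>UNIV. Re (v $ i) *\<^sub>R axis i 1 + Im (v $ i) *\<^sub>R axis i \<i>)"
    by (simp add: vec_eq_iff axis_def sum.distrib if_distrib[of "\<lambda>u. _ *\<^sub>R u"] complex_eq_iff cong: if_cong)
  from arg_cong[OF this, of L]
  have "L v = (\<Sum>i\<in>UNIV. Re (v $ i) *\<^sub>R L (axis i 1) + Im (v $ i) *\<^sub>R L (axis i \<i>))"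
    by (simp only: linear_sum[OF lin] linear_add[OF lin] linear_scale[OF lin])
  also have "\<dots> = (\<Sum>i\<in>UNIV. v $ i * wirt i f p + cnj (v $ i) * wirt_bar i f p)"
  proof (rule sum.cong[OF refl])
    fix i
    show "Re (v $ i) *\<^sub>R L (axis i 1) + Im (v $ i) *\<^sub>R L (axis i \<i>) =
        v $ i * wirt i f p + cnj (v $ i) * wirt_bar i f p"
      by (simp add: wirt_def wirt_bar_def dd complex_eq_iff field_simps)
  qed
  finally show ?thesis .
qed

text \<open>
  The operators \<open>frakX\<close> are the coefficients, with respect to \<open>k\<close> and its conjugate, of the derivative in
  the direction \<open>(k, A k)\<close> tangent to the graph of a solution.
\<close>

lemma derivative_along_system:
  assumes f: "(f has_derivative L) (at p)"
  shows "L (join k (pfaff (\<lambda>\<xi> l. X \<xi> l p) k)) =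
    (\<Sum>\<zeta>\<in>UNIV. k $ \<zeta> * frakX X (Inl \<zeta>) f p + cnj (k $ \<zeta>) * frakX X (Inr \<zeta>) f p)"
proof -
  have "L (join k (pfaff (\<lambda>\<xi> l. X \<xi> l p) k)) = 
    (\<Sum>\<zeta>\<in>UNIV. k $ \<zeta> * wirt (Inl \<zeta>) f p + cnj (k $ \<zeta>) * wirt_bar (Inl \<zeta>) f p) +
    (\<Sum>\<xi>\<in>UNIV. \<Sum>\<zeta>\<in>UNIV. (X \<xi> (Inl \<zeta>) p * k $ \<zeta> + X \<xi> (Inr \<zeta>) p * cnj (k $ \<zeta>)) * wirt (Inr \<xi>) f p +
       (cnj (X \<xi> (Inl \<zeta>) p) * cnj (k $ \<zeta>) + cnj (X \<xi> (Inr \<zeta>) p) * k $ \<zeta>) * wirt_bar (Inr \<xi>) f p)"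
    unfolding has_derivative_eq_wirtinger[OF f] sum_UNIV_Plus join_nth pfaff_def vec_lambda_beta
    by (simp add: sum_distrib_right sum.distrib distrib_right)
  also have "\<dots> = (\<Sum>\<zeta>\<in>UNIV. k $ \<zeta> * frakX X (Inl \<zeta>) f p + cnj (k $ \<zeta>) * frakX X (Inr \<zeta>) f p)"
    by (subst sum.swap) (simp add: sum.distrib sum_distrib_left algebra_simps)
  finally show ?thesis .
qed

text \<open>
  By the preceding lemma both sides are double sums over the coordinates of \<open>h\<close> and \<open>k\<close> and their
  conjugates; the three families of Frobenius conditions match the coefficients of the holomorphic,
  the antiholomorphic and the mixed products.
\<close>

lemma frobenius_symmetry:
  assumes X: "\<And>\<tau> l. (X \<tau> l has_derivative L \<tau> l) (at p)"
    and cs: "completely_solvable X G" "p \<in> G"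
  shows "pfaff (\<lambda>\<tau> l. L \<tau> l (join k (pfaff (\<lambda>\<xi> l. X \<xi> l p) k))) h =
         pfaff (\<lambda>\<tau> l. L \<tau> l (join h (pfaff (\<lambda>\<xi> l. X \<xi> l p) h))) k"
proof -
  have sym: "frakX X (Inl \<zeta>) (X \<tau> (Inl j)) p = frakX X (Inl j) (X \<tau> (Inl \<zeta>)) p"
    "frakX X (Inr \<zeta>) (X \<tau> (Inr j)) p = frakX X (Inr j) (X \<tau> (Inr \<zeta>)) p"
    "frakX X (Inl \<zeta>) (X \<tau> (Inr j)) p = frakX X (Inr j) (X \<tau> (Inl \<zeta>)) p" for \<tau> \<zeta> j
    using cs unfolding completely_solvable_def by blast+
  define Q where "Q \<tau> \<zeta> j = 
     k $ \<zeta> * h $ j * frakX X (Inl \<zeta>) (X \<tau> (Inl j)) p + cnj (k $ \<zeta>) * h $ j * frakX X (Inr \<zeta>) (X \<tau> (Inl j)) p +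
     k $ \<zeta> * cnj (h $ j) * frakX X (Inl \<zeta>) (X \<tau> (Inr j)) p + 
     cnj (k $ \<zeta>) * cnj (h $ j) * frakX X (Inr \<zeta>) (X \<tau> (Inr j)) p" for \<tau> \<zeta> j
  have left: "pfaff (\<lambda>\<tau> l. L \<tau> l (join k (pfaff (\<lambda>\<xi> l. X \<xi> l p) k))) h $ \<tau> = 
    (\<Sum>j\<in>UNIV. \<Sum>\<zeta>\<in>UNIV. Q \<tau> \<zeta> j)" for \<tau>
    unfolding pfaff_def[of _ h] vec_lambda_beta derivative_along_system[OF X] Q_def
    by (simp add: sum_distrib_left sum.distrib algebra_simps del: frakX.simps)
  define R where "R \<tau> \<zeta> j = 
     k $ \<zeta> * h $ j * frakX X (Inl j) (X \<tau> (Inl \<zeta>)) p + cnj (k $ \<zeta>) * h $ j * frakX X (Inl j) (X \<tau> (Inr \<zeta>)) p +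
     k $ \<zeta> * cnj (h $ j) * frakX X (Inr j) (X \<tau> (Inl \<zeta>)) p + 
     cnj (k $ \<zeta>) * cnj (h $ j) * frakX X (Inr j) (X \<tau> (Inr \<zeta>)) p" for \<tau> \<zeta> j
  have right: "pfaff (\<lambda>\<tau> l. L \<tau> l (join h (pfaff (\<lambda>\<xi> l. X \<xi> l p) h))) k $ \<tau> = 
    (\<Sum>\<zeta>\<in>UNIV. \<Sum>j\<in>UNIV. R \<tau> \<zeta> j)" for \<tau>
    unfolding pfaff_def[of _ k] vec_lambda_beta derivative_along_system[OF X] R_def
    by (simp add: sum_distrib_left sum.distrib algebra_simps del: frakX.simps)
  have "Q \<tau> \<zeta> j = R \<tau> \<zeta> j" for \<tau> \<zeta> j
    unfolding Q_def R_def sym(1)[of \<zeta> \<tau> j] sym(2)[of \<zeta> \<tau> j] sym(3)[of \<zeta> \<tau> j] sym(3)[of j \<tau> \<zeta>] ..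
  then have "(\<Sum>j\<in>UNIV. \<Sum>\<zeta>\<in>UNIV. Q \<tau> \<zeta> j) = (\<Sum>\<zeta>\<in>UNIV. \<Sum>j\<in>UNIV. R \<tau> \<zeta> j)" for \<tau>
    by (subst sum.swap) simp
  then show ?thesis
    by (simp only: vec_eq_iff left right) simp
qed

lemma has_vector_derivative_vec:
  fixes f :: "real \<Rightarrow> complex ^ 'n::finite"
  assumes "\<And>i. ((\<lambda>t. f t $ i) has_vector_derivative f' $ i) (at t within S)"
  shows "(f has_vector_derivative f') (at t within S)"
  unfolding has_vector_derivative_def
  by (rule has_derivative_vec) (use assms in \<open>simp add: has_vector_derivative_def\<close>)

lemma pfaff_lipschitz:
  fixes Y :: "'n::finite \<Rightarrow> 'm::finite + 'm \<Rightarrow> complex ^ 'k::finite \<Rightarrow> complex"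
  assumes Y: "\<And>\<xi> l. series_bounded (2 * \<rho>) M (Y \<xi> l)" and p: "norm p \<le> \<rho> / 2" and q: "norm q \<le> \<rho> / 2"
  shows "norm (pfaff (\<lambda>\<xi> l. Y \<xi> l q) h - pfaff (\<lambda>\<xi> l. Y \<xi> l p) h) \<le>
    real (2 * CARD('n) * CARD('m)) * (2 * M / \<rho>) * norm (q - p) * norm h"
proof -
  have \<rho>: "0 < \<rho>" using series_bounded_pos[OF Y] by simp
  have "norm (Y \<xi> l q - Y \<xi> l p) \<le> 2 * M / \<rho> * norm (q - p)" for \<xi> l
    using series_bounded_lipschitz[OF Y[of \<xi> l] in_polydisc_of_norm, of p "q - p"] p q \<rho>
      norm_triangle_ineq4[of q p] by simp
  then have "norm (pfaff (\<lambda>\<xi> l. Y \<xi> l q - Y \<xi> l p) h) \<le>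
      real (2 * CARD('n) * CARD('m)) * (2 * M / \<rho> * norm (q - p)) * norm h"
    by (rule norm_pfaff_le)
  then show ?thesis
    unfolding pfaff_diff by (simp only: mult.assoc)
qed

section \<open>From radial solutions to total solutions\<close>

lemma has_derivative_of_quadratic_bound:
  assumes "bounded_linear f'" "0 < e"
    and "\<And>y. y \<in> S \<Longrightarrow> norm (y - x) < e \<Longrightarrow> norm (f y - f x - f' (y - x)) \<le> C * (norm (y - x))\<^sup>2"
  shows "(f has_derivative f') (at x within S)"
proof (rule has_derivativeI_sandwich[OF assms(2,1)])
  fix y assume y: "y \<in> S" "y \<noteq> x" "dist y x < e"
  then show "norm (f y - f x - f' (y - x)) / norm (y - x) \<le> C * norm (y - x)"
    using assms(3)[of y] by (simp add: dist_norm divide_le_eq power2_eq_square mult_ac)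
next
  have "((\<lambda>y. C * norm (y - x)) \<longlongrightarrow> C * norm (x - x)) (at x within S)"
    by (intro tendsto_intros)
  then show "((\<lambda>y. C * norm (y - x)) \<longlongrightarrow> 0) (at x within S)" by simp
qed

text \<open>
  A substitute for Gronwall's inequality on the unit interval: at a maximum \<open>m\<close> of \<open>|v|\<close> the mean value
  inequality gives \<open>|v(m)| \<le> C + |v(m)| / 2\<close>.
\<close>

lemma norm_le_of_half_linear_growth:
  fixes v :: "real \<Rightarrow> 'b::real_normed_vector"
  assumes v: "\<And>t. t \<in> {0..1} \<Longrightarrow> (v has_vector_derivative v' t) (at t within {0..1})" and v0: "v 0 = 0"
    and le: "\<And>t. t \<in> {0..1} \<Longrightarrow> norm (v' t) \<le> C + norm (v t) / 2"
    and t: "t \<in> {0..1}"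
  shows "norm (v t) \<le> 2 * C"
proof -
  have "continuous_on {0..1} v"
    using v has_vector_derivative_continuous continuous_on_eq_continuous_within by blast
  then have "continuous_on {0..1} (\<lambda>t. norm (v t))" by (rule continuous_on_norm)
  then obtain m where m: "m \<in> {0..1}" "\<And>t. t \<in> {0..1} \<Longrightarrow> norm (v t) \<le> norm (v m)"
    using continuous_attains_sup[of "{0..1}" "\<lambda>t. norm (v t)"] by auto
  have "norm (v m - v 0) \<le> (C + norm (v m) / 2) * norm (m - 0)"
  proof (rule differentiable_bound[where S = "{0..1}"])
    show "(v has_derivative (\<lambda>x. x *\<^sub>R v' t)) (at t within {0..1})" if "t \<in> {0..1}" for t
      using v[OF that] by (simp add: has_vector_derivative_def)
    show "onorm (\<lambda>x. x *\<^sub>R v' t) \<le> C + norm (v m) / 2" if "t \<in> {0..1}" for t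
    proof (rule onorm_bound)
      show "0 \<le> C + norm (v m) / 2"
        using le[OF that] m(2)[OF that] norm_ge_zero[of "v' t"] by linarith
      show "norm (x *\<^sub>R v' t) \<le> (C + norm (v m) / 2) * norm x" for x
        using mult_left_mono[of "norm (v' t)" "C + norm (v m) / 2" "norm x"] le[OF that] m(2)[OF that]
        by (simp add: mult.commute)
    qed
  qed (use m in auto)
  also have "\<dots> \<le> (C + norm (v m) / 2) * 1"
  proof (rule mult_left_mono)
    show "0 \<le> C + norm (v m) / 2"
      using le[OF m(1)] norm_ge_zero[of "v' m"] by linarith
  qed (use m in auto)
  finally have "norm (v m) \<le> 2 * C" using v0 by simp
  then show ?thesis using m(2)[OF t] by simp
qed

text \<open>
  Solving the system along every ray is enough when \<open>DA(k, A k) h\<close> is symmetric in \<open>h\<close> and \<open>k\<close>.  The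
  argument estimates an increment of \<open>u\<close>, with the Lipschitz bound for \<open>u\<close> in the place of second
  derivatives.  The condition \<open>K \<delta> \<le> 1 / 2\<close> restricts to a ball so small that, up to
  a term quadratic in \<open>h\<close>, the defect grows at most at half its size.
\<close>

lemma radial_solution_is_total_solution:
  fixes A :: "'a::real_normed_vector \<times> 'b::real_normed_vector \<Rightarrow> 'a \<Rightarrow> 'b"
    and DA :: "'a \<times> 'b \<Rightarrow> 'a \<times> 'b \<Rightarrow> 'a \<Rightarrow> 'b"
    and u :: "'a \<Rightarrow> 'b"
  assumes K: "0 \<le> K" "K * \<delta> \<le> 1 / 2"
    and A_linear: "\<And>p. p \<in> S \<Longrightarrow> bounded_linear (A p)"
    and A_lipschitz: "\<And>p q h. p \<in> S \<Longrightarrow> q \<in> S \<Longrightarrow> norm (A q h - A p h) \<le> K * norm (q - p) * norm h"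
    and A_taylor: "\<And>p q h. p \<in> S \<Longrightarrow> q \<in> S \<Longrightarrow>
        norm (A q h - A p h - DA p (q - p) h) \<le> K * (norm (q - p))\<^sup>2 * norm h"
    and DA_linear: "\<And>p h. p \<in> S \<Longrightarrow> linear (\<lambda>v. DA p v h)"
    and DA_bound: "\<And>p v h. p \<in> S \<Longrightarrow> norm (DA p v h) \<le> K * norm v * norm h"
    and frobenius: "\<And>p h k. p \<in> S \<Longrightarrow> DA p (k, A p k) h = DA p (h, A p h) k"
    and u_S: "\<And>z. z \<in> ball 0 \<delta> \<Longrightarrow> (z, u z) \<in> S"
    and u_lipschitz: "\<And>z y. z \<in> ball 0 \<delta> \<Longrightarrow> y \<in> ball 0 \<delta> \<Longrightarrow> norm (u y - u z) \<le> K * norm (y - z)"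
    and u_radial: "\<And>z t. z \<in> ball 0 \<delta> \<Longrightarrow> t \<in> {0..1} \<Longrightarrow>
        ((\<lambda>t. u (t *\<^sub>R z)) has_vector_derivative A (t *\<^sub>R z, u (t *\<^sub>R z)) z) (at t within {0..1})"
    and z: "z \<in> ball 0 \<delta>"
  shows "(u has_derivative A (z, u z)) (at z)"
proof -
  have scale: "t *\<^sub>R y \<in> ball 0 \<delta>" if "y \<in> ball 0 \<delta>" "t \<in> {0..1}" for t :: real and y :: 'a
  proof -
    have "\<bar>t\<bar> * norm y \<le> 1 * norm y" using that(2) by (intro mult_right_mono) auto
    then show ?thesis using that(1) by simp
  qed
  define C where "C = K * (1 + K) + (1 + K)\<^sup>2 / 2"
  have main: "norm (u (z + h) - u z - A (z, u z) h) \<le> 2 * (C * (norm h)\<^sup>2)" if h: "z + h \<in> ball 0 \<delta>" for h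
  proof -
    define p q where "p t = (t *\<^sub>R z, u (t *\<^sub>R z))" and "q t = (t *\<^sub>R (z + h), u (t *\<^sub>R (z + h)))" for t
    define v where "v t = u (t *\<^sub>R (z + h)) - u (t *\<^sub>R z) - t *\<^sub>R A (p t) h" for t
    define v' where "v' t = A (q t) (z + h) - A (p t) z - (A (p t) h + t *\<^sub>R DA (p t) (z, A (p t) z) h)" for t
    have pS: "p t \<in> S" and qS: "q t \<in> S" if "t \<in> {0..1}" for t
      using u_S scale[OF z that] scale[OF h that] by (auto simp: p_def q_def)
    have dv: "(v has_vector_derivative v' t) (at t within {0..1})" if t: "t \<in> {0..1}" for t
    proof -
      have dp: "(p has_derivative (\<lambda>x. x *\<^sub>R (z, A (p t) z))) (at t within {0..1})"
        unfolding p_def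
        unfolding scaleR_Pair
        by (rule has_derivative_Pair[OF has_derivative_scaleR_left[OF has_derivative_ident]
              u_radial[OF z t, unfolded has_vector_derivative_def]])
      have "((\<lambda>r. A r h) has_derivative (\<lambda>w. DA (p t) w h)) (at (p t) within S)"
      proof (rule has_derivative_of_quadratic_bound[of _ 1])
        show "bounded_linear (\<lambda>w. DA (p t) w h)"
        proof (rule bounded_linear_intro)
          note lin = DA_linear[OF pS[OF t], of h]
          show "DA (p t) (w + w') h = DA (p t) w h + DA (p t) w' h" for w w'
            by (rule linear_add[OF lin])
          show "DA (p t) (x *\<^sub>R w) h = x *\<^sub>R DA (p t) w h" for x w
            by (rule linear_scale[OF lin])
          show "norm (DA (p t) w h) \<le> norm w * (K * norm h)" for w
            using DA_bound[OF pS[OF t], of w h] by (simp only: mult_ac)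
        qed
        show "norm (A r h - A (p t) h - DA (p t) (r - p t) h) \<le> K * norm h * (norm (r - p t))\<^sup>2" if "r \<in> S" for r
          using A_taylor[OF pS[OF t] that, of h] by (simp add: mult_ac)
      qed simp
      then have "((\<lambda>r. A r h) has_derivative (\<lambda>w. DA (p t) w h)) (at (p t) within p ` {0..1})"
        by (rule has_derivative_subset) (use pS in auto)
      from has_derivative_in_compose[OF dp this]
      have dA: "((\<lambda>t. A (p t) h) has_vector_derivative DA (p t) (z, A (p t) z) h) (at t within {0..1})"
        unfolding has_vector_derivative_def linear_scale[OF DA_linear[OF pS[OF t]]] .
      have "((\<lambda>t. t *\<^sub>R A (p t) h) has_vector_derivative (t *\<^sub>R DA (p t) (z, A (p t) z) h + 1 *\<^sub>R A (p t) h))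
          (at t within {0..1})"
        by (intro has_vector_derivative_scaleR dA DERIV_ident)
      then show ?thesis
        unfolding v_def v'_def using u_radial[OF h t] u_radial[OF z t]
        by (auto intro!: has_vector_derivative_diff simp: p_def q_def add.commute)
    qed
    have v'_le: "norm (v' t) \<le> C * (norm h)\<^sup>2 + norm (v t) / 2" if t: "t \<in> {0..1}" for t
    proof -
      note pt = pS[OF t] and qt = qS[OF t]
      have lin: "linear (\<lambda>w. DA (p t) w z)" by (rule DA_linear[OF pt])
      \<comment> \<open>The two points of the graph differ by a vector tangent to a solution, up to the defect.\<close>
      have split: "q t - p t = t *\<^sub>R (h, A (p t) h) + (0, v t)"
        by (simp add: p_def q_def v_def algebra_simps)
      have qp: "norm (q t - p t) \<le> (1 + K) * norm h"
      proof -
        have "norm (t *\<^sub>R h) \<le> norm h" using t by (simp add: mult_left_le_one_le)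
        moreover have "norm (u (t *\<^sub>R (z + h)) - u (t *\<^sub>R z)) \<le> K * norm (t *\<^sub>R h)"
          using u_lipschitz[OF scale[OF z t] scale[OF h t]] by (simp add: algebra_simps)
        moreover have "K * norm (t *\<^sub>R h) \<le> K * norm h"
          using calculation(1) K(1) by (rule mult_left_mono)
        moreover have "norm (q t - p t) \<le> norm (t *\<^sub>R h) + norm (u (t *\<^sub>R (z + h)) - u (t *\<^sub>R z))"
          using norm_Pair_le[of "t *\<^sub>R h" "u (t *\<^sub>R (z + h)) - u (t *\<^sub>R z)"]
          by (simp add: p_def q_def algebra_simps)
        ultimately show ?thesis by (simp add: algebra_simps)
      qed
      have zK: "K * norm z \<le> 1 / 2"
        using z K mult_left_mono[of "norm z" \<delta> K] by simp
      have addA: "A (q t) (z + h) = A (q t) z + A (q t) h"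
        by (rule linear_add[OF bounded_linear.linear[OF A_linear[OF qt]]])
      \<comment> \<open>The Frobenius symmetry turns the first-order term of \<open>A (q t) z\<close> into the term of \<open>v'\<close> that
        comes from differentiating \<open>A (p t) h\<close>.\<close>
      have "DA (p t) (q t - p t) z = t *\<^sub>R DA (p t) (z, A (p t) z) h + DA (p t) (0, v t) z"
        unfolding split linear_add[OF lin] linear_scale[OF lin] frobenius[OF pt, of h z] by simp
      then have "v' t = (A (q t) h - A (p t) h) + (A (q t) z - A (p t) z - DA (p t) (q t - p t) z) + DA (p t) (0, v t) z"
        unfolding v'_def addA by simp
      then have "norm (v' t) \<le> norm (A (q t) h - A (p t) h) + norm (A (q t) z - A (p t) z - DA (p t) (q t - p t) z)
          + norm (DA (p t) (0, v t) z)"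
        using norm_triangle_ineq order_trans add_right_mono by metis
      moreover have "norm (A (q t) h - A (p t) h) \<le> K * (1 + K) * (norm h)\<^sup>2"
      proof -
        have "norm (A (q t) h - A (p t) h) \<le> K * norm (q t - p t) * norm h"
          by (rule A_lipschitz[OF pt qt])
        also have "\<dots> \<le> K * ((1 + K) * norm h) * norm h"
          using qp K by (intro mult_left_mono mult_right_mono) auto
        finally show ?thesis by (simp add: power2_eq_square mult_ac)
      qed
      moreover have "norm (A (q t) z - A (p t) z - DA (p t) (q t - p t) z) \<le> (1 + K)\<^sup>2 / 2 * (norm h)\<^sup>2"
      proof -
        have "norm (A (q t) z - A (p t) z - DA (p t) (q t - p t) z) \<le> K * (norm (q t - p t))\<^sup>2 * norm z"
          by (rule A_taylor[OF pt qt])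
        also have "\<dots> = (K * norm z) * (norm (q t - p t))\<^sup>2" by simp
        also have "\<dots> \<le> 1 / 2 * ((1 + K) * norm h)\<^sup>2"
          using zK qp K by (intro mult_mono power_mono) auto
        finally show ?thesis by (simp add: power_mult_distrib)
      qed
      moreover have "norm (DA (p t) (0, v t) z) \<le> norm (v t) / 2"
      proof -
        have "norm (DA (p t) (0, v t) z) \<le> K * norm (0 :: 'a, v t) * norm z"
          by (rule DA_bound[OF pt])
        also have "\<dots> = (K * norm z) * norm (v t)" by (simp add: norm_Pair)
        also have "\<dots> \<le> 1 / 2 * norm (v t)" using zK by (intro mult_right_mono) auto
        finally show ?thesis by simp
      qed
      ultimately show ?thesis by (simp add: C_def algebra_simps)
    qed
    have "v 0 = 0" by (simp add: v_def)
    from norm_le_of_half_linear_growth[OF dv this v'_le, of 1]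
    show ?thesis by (simp add: v_def p_def)
  qed
  define e where "e = \<delta> - norm z"
  show ?thesis
  proof (rule has_derivative_of_quadratic_bound[of _ e])
    show "bounded_linear (A (z, u z))" by (rule A_linear[OF u_S[OF z]])
    show "0 < e" using z by (simp add: e_def)
    fix y assume "norm (y - z) < e"
    then have "norm y < \<delta>" using norm_triangle_ineq[of z "y - z"] by (simp add: e_def)
    then show "norm (u y - u z - A (z, u z) (y - z)) \<le> 2 * C * (norm (y - z))\<^sup>2"
      using main[of "y - z"] by simp
  qed
qed

section \<open>Existence\<close>

text \<open>
  The operator \<open>T\<close> is the right-hand side of the radial integral equation.  Because the
  integrals are multiplied by the coordinates and their conjugates, the norms of \<open>T 0\<close> and of
  \<open>T v - T w\<close> carry the factor \<open>2 m r\<close>, so a small radius \<open>r\<close> makes the one small and \<open>T\<close> a contraction.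
\<close>

lemma radial_solution_exists:
  fixes Y :: "'n::finite \<Rightarrow> 'm::finite + 'm \<Rightarrow> complex ^ ('m + 'n) \<Rightarrow> complex"
  assumes \<sigma>: "0 < \<sigma>" and Y: "\<And>\<xi> l. series_bounded (2 * \<sigma>) M (Y \<xi> l)" and M: "0 < M"
  obtains u :: "complex ^ 'm \<Rightarrow> complex ^ 'n" and r where "0 < r" "r \<le> \<sigma>"
    "\<And>\<xi>. series_bounded r \<sigma> (\<lambda>z. u z $ \<xi>)" "u 0 = 0"
    "\<And>z t. \<lbrakk>z \<in> polydisc r; t \<in> {0..1}\<rbrakk> \<Longrightarrow> ((\<lambda>t. u (t *\<^sub>R z)) has_vector_derivative
        pfaff (\<lambda>\<xi> l. Y \<xi> l (join (t *\<^sub>R z) (u (t *\<^sub>R z)))) z) (at t within {0..1})"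
proof -
  define m where "m = real CARD('m)"
  have m: "0 < m" by (simp add: m_def)
  \<comment> \<open>The factor \<open>4\<close> makes \<open>2 m r M \<le> \<sigma> / 2\<close>, the bound on \<open>T 0\<close> and, relative to \<open>\<sigma>\<close>, the
    contraction constant.\<close>
  define r where "r = min \<sigma> (\<sigma> / (4 * m * M))"
  have r: "0 < r" "r \<le> \<sigma>" using \<sigma> m M by (simp_all add: r_def)
  have rM: "4 * m * M * r \<le> \<sigma>"
    using m M mult_left_mono[of r "\<sigma> / (4 * m * M)" "4 * m * M"] by (simp add: r_def)
  define F where "F u \<xi> l z = Y \<xi> l (join z (u z))" for u \<xi> l z
  define J where "J u \<xi> l z = integral {0..1} (\<lambda>t. F u \<xi> l (t *\<^sub>R z))" for u \<xi> l z
  define T where "T u z = pfaff (\<lambda>\<xi> l. J u \<xi> l z) z" for u z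
  have joined: "series_bounded r \<sigma> (\<lambda>z. join z (u z) $ i)"
    if "\<And>\<xi>. series_bounded r \<sigma> (\<lambda>z. u z $ \<xi>)" for u :: "complex ^ 'm \<Rightarrow> complex ^ 'n" and i
  proof (cases i)
    case (Inl j)
    then show ?thesis using series_bounded_mono[OF series_bounded_coord[OF r(1)] r(2)] by simp
  qed (use that in simp)
  have F: "series_bounded r M (F u \<xi> l)" if u: "\<And>\<xi>. series_bounded r \<sigma> (\<lambda>z. u z $ \<xi>)" for u \<xi> l
    unfolding F_def
    by (rule series_bounded_compose[OF Y r(1)], rule series_bounded_mono[OF joined[OF u]]) (use \<sigma> in simp_all)
  have T_bound: "series_bounded r (2 * m * r * B) (\<lambda>z. pfaff (\<lambda>\<xi> l. c \<xi> l z) z $ \<xi>)"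
    if "\<And>\<xi> l. series_bounded r B (c \<xi> l)" for c :: "'n \<Rightarrow> 'm + 'm \<Rightarrow> complex ^ 'm \<Rightarrow> complex" and B \<xi>
  proof -
    have "series_bounded r (\<Sum>j\<in>(UNIV :: 'm set). B * r + B * r)
        (\<lambda>z. \<Sum>j\<in>UNIV. c \<xi> (Inl j) z * z $ j + c \<xi> (Inr j) z * cnj (z $ j))"
      by (intro series_bounded_sum series_bounded_add series_bounded_mult series_bounded_cnj
          series_bounded_coord r that)
    then show ?thesis by (simp add: pfaff_def m_def algebra_simps)
  qed
  obtain u where u: "\<And>\<xi>. series_bounded r \<sigma> (\<lambda>z. u z $ \<xi>)" and fixpt: "\<And>z. z \<in> polydisc r \<Longrightarrow> u z = T u z"
  proof (rule series_bounded_fixed_point[of r \<sigma> T])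
    show "series_bounded r (\<sigma> / 2) (\<lambda>z. T (\<lambda>_. 0) z $ \<xi>)" for \<xi>
      unfolding T_def
    proof (rule series_bounded_mono[OF T_bound])
      show "series_bounded r M (J (\<lambda>_. 0) \<xi> l)" for \<xi> l
        unfolding J_def using series_bounded_zero[OF r(1), of \<sigma>] \<sigma>
        by (intro series_bounded_radial_integral F) simp
      show "2 * m * r * M \<le> \<sigma> / 2" using rM by (simp add: mult_ac)
    qed
    fix v w :: "complex ^ 'm \<Rightarrow> complex ^ 'n" and \<epsilon> \<xi>
    assume v: "\<And>\<xi>. series_bounded r \<sigma> (\<lambda>z. v z $ \<xi>)" and w: "\<And>\<xi>. series_bounded r \<sigma> (\<lambda>z. w z $ \<xi>)"
      and vw: "\<And>\<xi>. series_bounded r \<epsilon> (\<lambda>z. v z $ \<xi> - w z $ \<xi>)"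
    have \<epsilon>: "0 \<le> \<epsilon>" by (rule series_bounded_nonneg[OF vw])
    have "series_bounded r \<epsilon> (\<lambda>z. join z (v z) $ i - join z (w z) $ i)" for i
    proof (cases i)
      case (Inl j)
      then show ?thesis using series_bounded_zero[OF r(1) \<epsilon>] by simp
    qed (use vw in simp)
    from series_bounded_compose_diff[OF Y r(1) joined[OF v] joined[OF w] this]
    have "series_bounded r (M * (\<epsilon> / \<sigma>)) (\<lambda>z. F v \<xi> l z - F w \<xi> l z)" for \<xi> l
      unfolding F_def .
    from series_bounded_radial_integral[OF this]
    have "series_bounded r (M * (\<epsilon> / \<sigma>)) (\<lambda>z. J v \<xi> l z - J w \<xi> l z)" for \<xi> l
    proof (rule series_bounded_cong)
      fix z :: "complex ^ 'm" assume z: "z \<in> polydisc r"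
      show "integral {0..1} (\<lambda>t. F v \<xi> l (t *\<^sub>R z) - F w \<xi> l (t *\<^sub>R z)) = J v \<xi> l z - J w \<xi> l z"
        unfolding J_def
        by (intro integral_diff integrable_continuous_real continuous_on_radial[OF F z] v w)
    qed
    from T_bound[of "M * (\<epsilon> / \<sigma>)" "\<lambda>\<xi> l z. J v \<xi> l z - J w \<xi> l z" \<xi>, OF this]
    have "series_bounded r (2 * m * r * (M * (\<epsilon> / \<sigma>))) (\<lambda>z. T v z $ \<xi> - T w z $ \<xi>)"
      unfolding T_def vector_minus_component[symmetric] pfaff_diff .
    moreover have "2 * m * r * (M * (\<epsilon> / \<sigma>)) \<le> \<epsilon> / 2"
    proof -
      have "(4 * m * M * r) * (\<epsilon> / \<sigma>) \<le> \<sigma> * (\<epsilon> / \<sigma>)"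
        using rM \<epsilon> \<sigma> by (intro mult_right_mono) auto
      then show ?thesis using \<sigma> by (simp add: mult_ac)
    qed
    ultimately show "series_bounded r (\<epsilon> / 2) (\<lambda>z. T v z $ \<xi> - T w z $ \<xi>)"
      by (rule series_bounded_mono)
  qed blast
  have "u 0 = 0"
    using fixpt[OF zero_in_polydisc] r(1) by (simp add: T_def pfaff_def vec_eq_iff)
  moreover have "((\<lambda>t. u (t *\<^sub>R z)) has_vector_derivative
        pfaff (\<lambda>\<xi> l. Y \<xi> l (join (t *\<^sub>R z) (u (t *\<^sub>R z)))) z) (at t within {0..1})"
    if z: "z \<in> polydisc r" and t: "t \<in> {0..1}" for z t
  proof (rule has_vector_derivative_vec)
    fix \<xi>
    let ?G = "\<lambda>l t. F u \<xi> l (t *\<^sub>R z)"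
    have G: "((\<lambda>t. t *\<^sub>R integral {0..1} (\<lambda>\<tau>. ?G l (\<tau> * t))) has_vector_derivative ?G l t) (at t within {0..1})" for l
      by (rule has_vector_derivative_radial_integral[OF continuous_on_radial[OF F[OF u] z] t])
    have "((\<lambda>t. \<Sum>j\<in>UNIV. (t *\<^sub>R integral {0..1} (\<lambda>\<tau>. ?G (Inl j) (\<tau> * t))) * z $ j
              + (t *\<^sub>R integral {0..1} (\<lambda>\<tau>. ?G (Inr j) (\<tau> * t))) * cnj (z $ j))
        has_vector_derivative (\<Sum>j\<in>UNIV. ?G (Inl j) t * z $ j + ?G (Inr j) t * cnj (z $ j)))
        (at t within {0..1})"
      by (intro has_vector_derivative_sum has_vector_derivative_add has_vector_derivative_mult_left G)
    then have "((\<lambda>t. u (t *\<^sub>R z) $ \<xi>) has_vector_derivative 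
        (\<Sum>j\<in>UNIV. ?G (Inl j) t * z $ j + ?G (Inr j) t * cnj (z $ j))) (at t within {0..1})"
    proof (rule has_vector_derivative_transform[OF t, rotated])
      fix s :: real assume "s \<in> {0..1}"
      from fixpt[OF polydisc_scaleR[OF z this]]
      have "u (s *\<^sub>R z) $ \<xi> = (\<Sum>j\<in>UNIV. J u \<xi> (Inl j) (s *\<^sub>R z) * (s *\<^sub>R z) $ j
            + J u \<xi> (Inr j) (s *\<^sub>R z) * cnj ((s *\<^sub>R z) $ j))"
        by (simp add: T_def pfaff_def)
      then show "u (s *\<^sub>R z) $ \<xi> = (\<Sum>j\<in>UNIV. (s *\<^sub>R integral {0..1} (\<lambda>\<tau>. ?G (Inl j) (\<tau> * s))) * z $ j
              + (s *\<^sub>R integral {0..1} (\<lambda>\<tau>. ?G (Inr j) (\<tau> * s))) * cnj (z $ j))"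
        by (simp add: J_def)
    qed
    then show "((\<lambda>t. u (t *\<^sub>R z) $ \<xi>) has_vector_derivative
        pfaff (\<lambda>\<xi> l. Y \<xi> l (join (t *\<^sub>R z) (u (t *\<^sub>R z)))) z $ \<xi>) (at t within {0..1})"
      by (simp add: pfaff_def F_def)
  qed
  ultimately show ?thesis using that[OF r u] by blast
qed

text \<open>
  After translation to the origin, one constant \<open>K\<close> serves for all the bounds on \<open>A\<close>, \<open>DA\<close> and \<open>u\<close>.  The
  radius \<open>\<sigma>\<close> of the range of \<open>u\<close> is chosen so that the graph stays within norm \<open>\<rho> / 2\<close>; any two points
  of that ball differ by at most \<open>\<rho>\<close>, which is the range of validity of the Taylor bound.
\<close>

lemma solution_exists:
  fixes X :: "'n::finite \<Rightarrow> 'm::finite + 'm \<Rightarrow> complex ^ ('m + 'n) \<Rightarrow> complex"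
  assumes cs: "completely_solvable X G"
    and X: "\<And>\<xi> l. R_holomorphic_at G (X \<xi> l) (join z0 w0)"
  shows "\<exists>D w. R_holomorphic_solution X G z0 w0 D w"
proof -
  define P where "P = join z0 w0"
  obtain \<rho> M where \<rho>: "0 < \<rho>" and M: "0 < M"
    and Y_all: "\<And>\<xi> l x. 0 < x \<Longrightarrow> x \<le> 2 * \<rho> \<Longrightarrow> series_bounded x M (\<lambda>s. X \<xi> l (P + s))"
    and G: "\<And>s. s \<in> polydisc (2 * \<rho>) \<Longrightarrow> P + s \<in> G"
    by (rule common_series_bound[where X = X, OF X[folded P_def]]) blast
  define Y where "Y \<xi> l = (\<lambda>s. X \<xi> l (P + s))" for \<xi> l
  have Y: "series_bounded x M (Y \<xi> l)" if "0 < x" "x \<le> 2 * \<rho>" for \<xi> l x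
    using Y_all[OF that] by (simp add: Y_def)
  have Y\<rho>: "series_bounded (2 * \<rho>) M (Y \<xi> l)" for \<xi> l using Y \<rho> by simp
  \<comment> \<open>\<open>n\<close> enters because bounds on the components of \<open>u\<close> are turned into bounds on its norm.\<close>
  define n where "n = real CARD('n)"
  have n: "0 < n" by (simp add: n_def)
  have n1: "1 \<le> n" by (simp add: n_def)
  define \<sigma> where "\<sigma> = \<rho> / (4 * n)"
  have \<sigma>: "0 < \<sigma>" "n * \<sigma> = \<rho> / 4" using \<rho> n by (simp_all add: \<sigma>_def)
  have "\<sigma> \<le> n * \<sigma>" using n1 \<sigma>(1) by simp
  then have \<sigma>\<rho>: "2 * \<sigma> \<le> 2 * \<rho>" using \<sigma>(2) \<rho> by simp
  obtain u :: "complex ^ 'm \<Rightarrow> complex ^ 'n" and r where r: "0 < r" "r \<le> \<sigma>"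
    and u: "\<And>\<xi>. series_bounded r \<sigma> (\<lambda>z. u z $ \<xi>)" and u0: "u 0 = 0"
    and radial: "\<And>z t. \<lbrakk>z \<in> polydisc r; t \<in> {0..1}\<rbrakk> \<Longrightarrow> ((\<lambda>t. u (t *\<^sub>R z)) has_vector_derivative
        pfaff (\<lambda>\<xi> l. Y \<xi> l (join (t *\<^sub>R z) (u (t *\<^sub>R z)))) z) (at t within {0..1})"
  proof (rule radial_solution_exists[where Y = Y, OF \<sigma>(1) Y M])
    show "0 < 2 * \<sigma>" "2 * \<sigma> \<le> 2 * \<rho>" using \<sigma> \<sigma>\<rho> by simp_all
  qed blast
  define N where "N = real (2 * CARD('n) * CARD('m))"
  have N: "0 \<le> N" by (simp add: N_def)
  define K where "K = max (N * (2 * M / \<rho>)) (max (N * (M / \<rho>\<^sup>2)) (max (N * (M / \<rho>)) (n * (4 * \<sigma> / r))))"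
  have K_ge: "N * (2 * M / \<rho>) \<le> K" "N * (M / \<rho>\<^sup>2) \<le> K" "N * (M / \<rho>) \<le> K" "n * (4 * \<sigma> / r) \<le> K"
    unfolding K_def by (simp_all only: le_max_iff_disj order_refl simp_thms)
  have "0 \<le> N * (M / \<rho>)" using N M \<rho> by simp
  with K_ge(3) have "0 \<le> K" by simp
  note K = this K_ge
  define \<delta> where "\<delta> = min (r / 4) (min (\<rho> / 4) (1 / (2 * (K + 1))))"
  have \<delta>: "0 < \<delta>" "\<delta> \<le> r / 4" "\<delta> \<le> \<rho> / 4" using r \<rho> K(1) by (simp_all add: \<delta>_def)
  have K\<delta>: "K * \<delta> \<le> 1 / 2"
  proof -
    have "K * \<delta> \<le> K * (1 / (2 * (K + 1)))" using K(1) by (intro mult_left_mono) (simp_all add: \<delta>_def)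
    also have "\<dots> \<le> 1 / 2" using K(1) by (simp add: divide_le_eq)
    finally show ?thesis .
  qed
  have taylor: "\<exists>L. bounded_linear L \<and> (\<forall>s. norm (L s) \<le> M * (norm s / \<rho>)) \<and>
           (\<forall>s. norm s \<le> \<rho> \<longrightarrow> norm (Y \<xi> l (p + s) - Y \<xi> l p - L s) \<le> M * (norm s / \<rho>)\<^sup>2)"
    if "p \<in> polydisc \<rho>" for \<xi> l p
    by (rule series_bounded_taylor_at[OF Y\<rho> that])
  \<comment> \<open>The linear part of the expansion at \<open>p\<close>, which is the derivative of the coefficient there.\<close>
  define L where "L \<xi> l p = (SOME L. bounded_linear L \<and> (\<forall>s. norm (L s) \<le> M * (norm s / \<rho>)) \<and>
           (\<forall>s. norm s \<le> \<rho> \<longrightarrow> norm (Y \<xi> l (p + s) - Y \<xi> l p - L s) \<le> M * (norm s / \<rho>)\<^sup>2))" for \<xi> l p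
  have L: "bounded_linear (L \<xi> l p)" "norm (L \<xi> l p s) \<le> M * (norm s / \<rho>)"
      "norm s \<le> \<rho> \<Longrightarrow> norm (Y \<xi> l (p + s) - Y \<xi> l p - L \<xi> l p s) \<le> M * (norm s / \<rho>)\<^sup>2"
    if "p \<in> polydisc \<rho>" for \<xi> l p s
    using someI_ex[OF taylor[OF that, of \<xi> l]] unfolding L_def by blast+
  define J where "J p = join (fst p) (snd p)" for p :: "(complex ^ 'm) \<times> (complex ^ 'n)"
  have J_add: "J (p + q) = J p + J q" and J_diff: "J (p - q) = J p - J q" and J_scale: "J (x *\<^sub>R p) = x *\<^sub>R J p"
    and norm_J: "norm (J p) = norm p" for p q x
    by (simp_all add: J_def join_add join_diff join_scaleR norm_join)
  define S where "S = {p :: (complex ^ 'm) \<times> (complex ^ 'n). norm p \<le> \<rho> / 2}"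
  have S_norm: "norm (J p) \<le> \<rho> / 2" and S_poly: "J p \<in> polydisc \<rho>" and S_G: "P + J p \<in> G" if "p \<in> S" for p
  proof -
    show le: "norm (J p) \<le> \<rho> / 2" using that by (simp add: S_def norm_J)
    then show "J p \<in> polydisc \<rho>" "P + J p \<in> G" using \<rho> by (auto intro!: in_polydisc_of_norm G)
  qed
  have S_diff: "norm (J q - J p) \<le> \<rho>" if "p \<in> S" "q \<in> S" for p q
    using S_norm[OF that(1)] S_norm[OF that(2)] norm_triangle_ineq4[of "J q" "J p"] by simp
  define A where "A p = pfaff (\<lambda>\<xi> l. Y \<xi> l (J p))" for p
  define DA where "DA p v = pfaff (\<lambda>\<xi> l. L \<xi> l (J p) (J v))" for p v
  have total: "(u has_derivative A (z, u z)) (at z)" and in_S: "(z, u z) \<in> S" if z: "z \<in> ball 0 \<delta>" for z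
  proof -
    have poly: "y \<in> polydisc r" "y \<in> polydisc (r / 2)" if "y \<in> ball 0 \<delta>" for y :: "complex ^ 'm"
      using that \<delta> r by (auto intro!: in_polydisc_of_norm)
    have u_S: "(y, u y) \<in> S" if y: "y \<in> ball 0 \<delta>" for y
    proof -
      have "norm (u y) \<le> \<rho> / 4"
        using norm_vec_le_card[of "u y" \<sigma>] series_bounded_norm_le[OF u poly(1)[OF y]] \<sigma>(2) by (simp add: n_def)
      then show ?thesis
        using y \<delta> norm_Pair_le[of y "u y"] by (simp add: S_def)
    qed
    then show "(z, u z) \<in> S" using z by simp
    show "(u has_derivative A (z, u z)) (at z)"
    proof (rule radial_solution_is_total_solution[where S = S and DA = DA, OF K(1) K\<delta> _ _ _ _ _ _ u_S _ _ z])
      show "bounded_linear (A p)" for p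
        unfolding A_def by (rule bounded_linear_pfaff)
      show "norm (A q h - A p h) \<le> K * norm (q - p) * norm h" if "p \<in> S" "q \<in> S" for p q h
      proof -
        have "norm (A q h - A p h) \<le> N * (2 * M / \<rho>) * norm (J q - J p) * norm h"
          unfolding A_def N_def by (rule pfaff_lipschitz[where Y = Y, OF Y\<rho> S_norm[OF that(1)] S_norm[OF that(2)]])
        also have "\<dots> \<le> K * norm (J q - J p) * norm h"
          using K by (intro mult_right_mono) auto
        finally show ?thesis by (simp add: J_diff[symmetric] norm_J)
      qed
      show "norm (A q h - A p h - DA p (q - p) h) \<le> K * (norm (q - p))\<^sup>2 * norm h" if "p \<in> S" "q \<in> S" for p q h
      proof -
        have "norm (Y \<xi> l (J q) - Y \<xi> l (J p) - L \<xi> l (J p) (J (q - p))) \<le> M * (norm (q - p) / \<rho>)\<^sup>2" for \<xi> l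
          using L(3)[OF S_poly[OF that(1)] S_diff[OF that], of \<xi> l] by (simp add: J_diff[symmetric] norm_J) (simp add: J_diff)
        then have "norm (A q h - A p h - DA p (q - p) h) \<le> N * (M * (norm (q - p) / \<rho>)\<^sup>2) * norm h"
          unfolding A_def DA_def pfaff_diff N_def by (rule norm_pfaff_le)
        also have "\<dots> = N * (M / \<rho>\<^sup>2) * ((norm (q - p))\<^sup>2 * norm h)" by (simp add: power_divide)
        also have "\<dots> \<le> K * ((norm (q - p))\<^sup>2 * norm h)" using K by (intro mult_right_mono) auto
        finally show ?thesis by (simp add: mult.assoc)
      qed
      show "linear (\<lambda>v. DA p v h)" if "p \<in> S" for p h
      proof (rule linearI)
        note lin = bounded_linear.linear[OF L(1)[OF S_poly[OF that]]]
        show "DA p (v + w) h = DA p v h + DA p w h" for v w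
          by (simp add: DA_def J_add linear_add[OF lin] pfaff_def vec_eq_iff distrib_right sum.distrib algebra_simps)
        show "DA p (x *\<^sub>R v) h = x *\<^sub>R DA p v h" for x v
          by (simp add: DA_def J_scale linear_scale[OF lin] pfaff_def vec_eq_iff scaleR_right.sum scaleR_add_right)
      qed
      show "norm (DA p v h) \<le> K * norm v * norm h" if "p \<in> S" for p v h
      proof -
        have "norm (L \<xi> l (J p) (J v)) \<le> M * (norm v / \<rho>)" for \<xi> l
          using L(2)[OF S_poly[OF that], of \<xi> l "J v"] by (simp add: norm_J)
        then have "norm (DA p v h) \<le> N * (M * (norm v / \<rho>)) * norm h"
          unfolding DA_def N_def by (rule norm_pfaff_le)
        also have "\<dots> = N * (M / \<rho>) * (norm v * norm h)" by simp
        also have "\<dots> \<le> K * (norm v * norm h)" using K by (intro mult_right_mono) auto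
        finally show ?thesis by (simp add: mult.assoc)
      qed
      show "DA p (k, A p k) h = DA p (h, A p h) k" if "p \<in> S" for p h k
      proof -
        have "(X \<xi> l has_derivative L \<xi> l (J p)) (at (P + J p))" for \<xi> l
        proof (rule has_derivative_of_quadratic_bound[OF L(1)[OF S_poly[OF that]] \<rho>])
          fix y assume "norm (y - (P + J p)) < \<rho>"
          then have "norm (Y \<xi> l (J p + (y - (P + J p))) - Y \<xi> l (J p) - L \<xi> l (J p) (y - (P + J p)))
              \<le> M * (norm (y - (P + J p)) / \<rho>)\<^sup>2"
            by (intro L(3) S_poly that) simp
          then show "norm (X \<xi> l y - X \<xi> l (P + J p) - L \<xi> l (J p) (y - (P + J p)))
              \<le> M / \<rho>\<^sup>2 * (norm (y - (P + J p)))\<^sup>2"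
            by (simp add: Y_def power_divide algebra_simps)
        qed
        from frobenius_symmetry[where X = X and L = "\<lambda>\<xi> l. L \<xi> l (J p)", OF this cs S_G[OF that], of k h]
        show ?thesis by (simp add: DA_def A_def Y_def J_def)
      qed
      show "norm (u y - u x) \<le> K * norm (y - x)" if x: "x \<in> ball 0 \<delta>" and y: "y \<in> ball 0 \<delta>" for x y
      proof -
        have s: "norm (y - x) \<le> r / 2"
          using x y \<delta> norm_triangle_ineq4[of y x] by simp
        have "norm ((u y - u x) $ \<xi>) \<le> 4 * \<sigma> / r * norm (y - x)" for \<xi>
          using series_bounded_lipschitz[of "r / 2" \<sigma> "\<lambda>z. u z $ \<xi>" x "y - x"] u poly(2)[OF x] s by simp
        from norm_vec_le_card[OF this]
        have "norm (u y - u x) \<le> n * (4 * \<sigma> / r) * norm (y - x)" by (simp add: n_def)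
        also have "\<dots> \<le> K * norm (y - x)" using K by (intro mult_right_mono) auto
        finally show ?thesis .
      qed
      show "((\<lambda>t. u (t *\<^sub>R y)) has_vector_derivative A (t *\<^sub>R y, u (t *\<^sub>R y)) y) (at t within {0..1})"
        if "y \<in> ball 0 \<delta>" "t \<in> {0..1}" for y t
        using radial[OF poly(1)[OF that(1)] that(2)] by (simp add: A_def J_def)
    qed
  qed
  define w where "w z = w0 + u (z - z0)" for z
  have join_w: "join z (w z) = P + J (z - z0, u (z - z0))" for z
    by (simp add: P_def J_def w_def join_add[symmetric])
  have "is_solution X G (ball z0 \<delta>) w"
    unfolding is_solution_def
  proof (intro conjI ballI allI)
    fix z assume "z \<in> ball z0 \<delta>"
    then have z: "z - z0 \<in> ball 0 \<delta>" by (simp add: dist_norm norm_minus_commute)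
    show "join z (w z) \<in> G" unfolding join_w by (rule S_G[OF in_S[OF z]])
    have "((\<lambda>z. u (z - z0)) has_derivative A (z - z0, u (z - z0))) (at z)"
      using has_derivative_compose[OF has_derivative_diff[OF has_derivative_ident has_derivative_const] total[OF z]]
      by simp
    then have "(w has_derivative A (z - z0, u (z - z0))) (at z)"
      using has_derivative_add[OF has_derivative_const] unfolding w_def by fastforce
    from bounded_linear.has_derivative[OF bounded_linear_vec_nth this]
    show "((\<lambda>z. w z $ \<xi>) has_derivative
       (\<lambda>h. \<Sum>j\<in>UNIV. X \<xi> (Inl j) (join z (w z)) * h $ j + X \<xi> (Inr j) (join z (w z)) * cnj (h $ j))) (at z)" for \<xi>
      unfolding join_w by (simp add: A_def pfaff_def Y_def)
  qed (simp_all add: connected_ball)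
  moreover have "R_holomorphic_at (ball z0 \<delta>) (\<lambda>z. w z $ \<xi>) z0" for \<xi>
  proof (rule R_holomorphic_of_series_bounded[OF _ order_refl])
    have "series_bounded \<delta> (norm (w0 $ \<xi>) + \<sigma>) (\<lambda>s. w0 $ \<xi> + u s $ \<xi>)"
      using \<delta> r by (intro series_bounded_add series_bounded_const series_bounded_shrink[OF u]) auto
    then show "series_bounded \<delta> (norm (w0 $ \<xi>) + \<sigma>) (\<lambda>s. w (z0 + s) $ \<xi>)" by (simp add: w_def)
  qed
  ultimately have "R_holomorphic_solution X G z0 w0 (ball z0 \<delta>) w"
    using \<delta>(1) by (simp add: R_holomorphic_solution_def R_holomorphic_vec_at_def w_def u0)
  then show ?thesis by blast
qed

section \<open>Uniqueness\<close>

lemma is_solution_has_derivative: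
  assumes "is_solution X G D w" "z \<in> D"
  shows "(w has_derivative pfaff (\<lambda>\<xi> l. X \<xi> l (join z (w z)))) (at z)"
  by (rule has_derivative_vec) (use assms in \<open>simp add: is_solution_def pfaff_def\<close>)

text \<open>
  Both graphs stay near their common point \<open>P\<close>, where the coefficients are Lipschitz with constant
  \<open>N\<close>.  On segments of length at most \<open>1 / (2 (N + 1))\<close> the derivative of the difference is bounded by half
  the difference, and the difference starts at zero.
\<close>

lemma solutions_agree_locally:
  fixes X :: "'n::finite \<Rightarrow> 'm::finite + 'm \<Rightarrow> complex ^ ('m + 'n) \<Rightarrow> complex"
  assumes X: "\<And>\<xi> l p. p \<in> G \<Longrightarrow> R_holomorphic_at G (X \<xi> l) p"
    and w1: "is_solution X G D1 w1" and w2: "is_solution X G D2 w2"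
    and a: "a \<in> D1" "a \<in> D2" "w1 a = w2 a"
  shows "\<exists>\<eta>>0. \<forall>z\<in>ball a \<eta>. w1 z = w2 z"
proof -
  define P where "P = join a (w1 a)"
  have "P \<in> G" using w1 a(1) by (simp add: is_solution_def P_def)
  obtain \<rho> M where \<rho>: "0 < \<rho>" and M: "0 < M"
    and Y_all: "\<And>\<xi> l x. 0 < x \<Longrightarrow> x \<le> 2 * \<rho> \<Longrightarrow> series_bounded x M (\<lambda>s. X \<xi> l (P + s))"
    by (rule common_series_bound[where X = X, OF X[OF \<open>P \<in> G\<close>]]) blast
  have Y: "series_bounded (2 * \<rho>) M (\<lambda>s. X \<xi> l (P + s))" for \<xi> l using Y_all \<rho> by simp
  define N where "N = real (2 * CARD('n) * CARD('m)) * (2 * M / \<rho>)"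
  have N: "0 \<le> N" using M \<rho> by (simp add: N_def)
  have near: "\<exists>\<eta>>0. \<forall>z\<in>ball a \<eta>. z \<in> D \<and> norm (join z (w z) - P) \<le> \<rho> / 2"
    if w: "is_solution X G D w" "a \<in> D" "w a = w1 a" for D w
  proof -
    have "isCont w a" 
      using is_solution_has_derivative[OF w(1,2)] has_derivative_continuous by blast
    then obtain d where d: "0 < d" "\<And>z. dist z a < d \<Longrightarrow> dist (w z) (w a) < \<rho> / 4"
      using \<rho> unfolding continuous_at_eps_delta by (metis divide_pos_pos zero_less_numeral)
    obtain e where e: "0 < e" "ball a e \<subseteq> D"
      using w(1,2) unfolding is_solution_def by (meson openE)
    show ?thesis
    proof (intro exI conjI ballI)
      show "0 < min (min d e) (\<rho> / 4)" using d e \<rho> by simp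
      fix z assume z: "z \<in> ball a (min (min d e) (\<rho> / 4))"
      then show "z \<in> D" using e by auto
      have "norm (join z (w z) - P) = norm (z - a, w z - w a)"
        unfolding P_def w(3)[symmetric] join_diff[symmetric] norm_join ..
      also have "\<dots> \<le> norm (z - a) + norm (w z - w a)" by (rule norm_Pair_le)
      also have "\<dots> \<le> \<rho> / 4 + \<rho> / 4"
        using z d(2)[of z] by (intro add_mono) (auto simp: dist_norm norm_minus_commute)
      finally show "norm (join z (w z) - P) \<le> \<rho> / 2" by simp
    qed
  qed
  from near[OF w1 a(1)] obtain e1 where e1: "0 < e1"
    "\<And>z. z \<in> ball a e1 \<Longrightarrow> z \<in> D1 \<and> norm (join z (w1 z) - P) \<le> \<rho> / 2" by auto
  from near[OF w2 a(2)] a(3) obtain e2 where e2: "0 < e2"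
    "\<And>z. z \<in> ball a e2 \<Longrightarrow> z \<in> D2 \<and> norm (join z (w2 z) - P) \<le> \<rho> / 2" by auto
  define \<eta> where "\<eta> = min (min e1 e2) (1 / (2 * (N + 1)))"
  have \<eta>: "0 < \<eta>" using e1 e2 N by (simp add: \<eta>_def)
  have "w1 z = w2 z" if z: "z \<in> ball a \<eta>" for z
  proof -
    define h where "h = z - a"
    have h: "norm h < \<eta>" using z by (simp add: h_def dist_norm norm_minus_commute)
    have Nh: "N * norm h \<le> 1 / 2"
    proof -
      have "N * norm h \<le> N * (1 / (2 * (N + 1)))" using N h by (intro mult_left_mono) (auto simp: \<eta>_def)
      also have "\<dots> \<le> 1 / 2" using N by (simp add: divide_le_eq)
      finally show ?thesis .
    qed
    define v where "v t = w1 (a + t *\<^sub>R h) - w2 (a + t *\<^sub>R h)" for t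
    define R where "R w t = pfaff (\<lambda>\<xi> l. X \<xi> l (join (a + t *\<^sub>R h) (w (a + t *\<^sub>R h)))) h" for w t
    have near_t: "a + t *\<^sub>R h \<in> ball a e1" "a + t *\<^sub>R h \<in> ball a e2" if "t \<in> {0..1}" for t
    proof -
      have "\<bar>t\<bar> * norm h \<le> 1 * norm h" using that by (intro mult_right_mono) auto
      then have "norm (t *\<^sub>R h) < \<eta>" using h by simp
      then show "a + t *\<^sub>R h \<in> ball a e1" "a + t *\<^sub>R h \<in> ball a e2" by (auto simp: \<eta>_def dist_norm)
    qed
    have along: "((\<lambda>t. w (a + t *\<^sub>R h)) has_vector_derivative R w t) (at t within {0..1})"
      if w: "is_solution X G D w" "a + t *\<^sub>R h \<in> D" for D w t
    proof -
      have "((\<lambda>t. a + t *\<^sub>R h) has_derivative (\<lambda>t. t *\<^sub>R h)) (at t within {0..1})"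
        by (auto intro!: derivative_eq_intros)
      from has_derivative_compose[OF this is_solution_has_derivative[OF w]]
      show ?thesis
        unfolding has_vector_derivative_def R_def linear_scale[OF bounded_linear.linear[OF bounded_linear_pfaff]] .
    qed
    have dv: "(v has_vector_derivative R w1 t - R w2 t) (at t within {0..1})" if "t \<in> {0..1}" for t
      unfolding v_def
      by (intro has_vector_derivative_diff along[OF w1] along[OF w2])
        (use near_t[OF that] e1(2) e2(2) in auto)
    have le: "norm (R w1 t - R w2 t) \<le> 0 + norm (v t) / 2" if "t \<in> {0..1}" for t
    proof -
      let ?p1 = "join (a + t *\<^sub>R h) (w1 (a + t *\<^sub>R h)) - P" and ?p2 = "join (a + t *\<^sub>R h) (w2 (a + t *\<^sub>R h)) - P"
      have "norm (R w1 t - R w2 t) \<le> N * norm (?p1 - ?p2) * norm h"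
        using pfaff_lipschitz[where Y = "\<lambda>\<xi> l s. X \<xi> l (P + s)", OF Y, where p = ?p2 and q = ?p1 and h = h] e1(2)[OF near_t(1)[OF that]]
          e2(2)[OF near_t(2)[OF that]]
        unfolding R_def N_def by simp
      also have "?p1 - ?p2 = join 0 (v t)" by (simp add: v_def join_diff[symmetric])
      also have "N * norm (join 0 (v t) :: complex ^ ('m + 'n)) * norm h = (N * norm h) * norm (v t)"
        by (simp add: norm_join norm_Pair)
      also have "\<dots> \<le> 1 / 2 * norm (v t)" using Nh by (intro mult_right_mono) auto
      finally show ?thesis by simp
    qed
    have "v 0 = 0" using a(3) by (simp add: v_def)
    from norm_le_of_half_linear_growth[OF dv this le, of 1]
    show ?thesis by (simp add: v_def h_def)
  qed
  with \<eta> show ?thesis by blast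
qed

lemma solutions_agree:
  fixes X :: "'n::finite \<Rightarrow> 'm::finite + 'm \<Rightarrow> complex ^ ('m + 'n) \<Rightarrow> complex"
  assumes X: "\<And>\<xi> l p. p \<in> G \<Longrightarrow> R_holomorphic_at G (X \<xi> l) p"
    and w1: "is_solution X G D1 w1" and w2: "is_solution X G D2 w2"
    and z0: "z0 \<in> D1" "z0 \<in> D2" "w1 z0 = w2 z0"
    and z: "z \<in> connected_component_set (D1 \<inter> D2) z0"
  shows "w1 z = w2 z"
proof -
  define W where "W = connected_component_set (D1 \<inter> D2) z0"
  have W: "W \<subseteq> D1" "W \<subseteq> D2" using connected_component_subset unfolding W_def by blast+
  have cont: "continuous_on W w" if "is_solution X G D w" "W \<subseteq> D" for w D
    using is_solution_has_derivative[OF that(1)] that(2) has_derivative_continuous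
    by (intro continuous_at_imp_continuous_on) blast
  define E where "E = {z \<in> W. w1 z = w2 z}"
  have "closedin (top_of_set W) E"
  proof -
    have "closedin (top_of_set W) {z \<in> W. w1 z - w2 z = 0}"
      by (intro continuous_closedin_preimage_constant continuous_on_diff cont[OF w1 W(1)] cont[OF w2 W(2)])
    then show ?thesis by (simp add: E_def)
  qed
  moreover have "openin (top_of_set W) E"
    unfolding openin_contains_ball
  proof (intro conjI ballI)
    fix a assume "a \<in> E"
    then obtain \<eta> where "0 < \<eta>" "\<forall>z\<in>ball a \<eta>. w1 z = w2 z"
      using solutions_agree_locally[OF X w1 w2, of a] W by (auto simp: E_def)
    then show "\<exists>e>0. ball a e \<inter> W \<subseteq> E" by (auto simp: E_def)
  qed (auto simp: E_def)
  moreover have "connected W" by (simp add: W_def)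
  moreover have "z0 \<in> E" using z0 by (simp add: E_def W_def)
  ultimately have "E = W" unfolding connected_clopen by blast
  then show ?thesis using z by (auto simp: E_def W_def)
qed

theorem theorem1p1:
  fixes G :: "(complex ^ ('m::finite + 'n::finite)) set"
    and X :: "'n \<Rightarrow> 'm + 'm \<Rightarrow> complex ^ ('m + 'n) \<Rightarrow> complex"
    and z0 :: "complex ^ 'm" and w0 :: "complex ^ 'n"
  assumes "open G" and "connected G"
    and "\<And>\<xi> l p. p \<in> G \<Longrightarrow> R_holomorphic_at G (X \<xi> l) p"
    and "completely_solvable X G"
    and "join z0 w0 \<in> G"
    and "\<And>\<xi> l. R_holomorphic_at G (X \<xi> l) (join z0 w0)"
  shows "(\<exists>D w. R_holomorphic_solution X G z0 w0 D w) \<and>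
         (\<forall>D1 w1 D2 w2.
            R_holomorphic_solution X G z0 w0 D1 w1 \<longrightarrow> R_holomorphic_solution X G z0 w0 D2 w2 \<longrightarrow>
            (\<forall>z \<in> connected_component_set (D1 \<inter> D2) z0. w1 z = w2 z))"
proof (intro conjI allI impI ballI)
  show "\<exists>D w. R_holomorphic_solution X G z0 w0 D w"
    by (rule solution_exists[OF assms(4,6)])
next
  fix D1 w1 D2 w2 z
  assume "R_holomorphic_solution X G z0 w0 D1 w1" "R_holomorphic_solution X G z0 w0 D2 w2"
    and z: "z \<in> connected_component_set (D1 \<inter> D2) z0"
  then have "is_solution X G D1 w1" "is_solution X G D2 w2" "z0 \<in> D1" "z0 \<in> D2" "w1 z0 = w2 z0"
    by (simp_all add: R_holomorphic_solution_def)
  from solutions_agree[OF assms(3) this z] show "w1 z = w2 z" .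
qed

end
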